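(* Let $\varphi:\mathbb D\to\mathbb E^3_1$ be a timelike surface of constant mean curvature $H$ with null coordinates $(x,y)$, first fundamental form $I=e^{\omega}\,\mathrm dx\,\mathrm dy$ and Hopf differentials $Q(x)\,\mathrm dx^2$, $R(y)\,\mathrm dy^2$. Then the normalized potentials of $\varphi$ with the origin as reference point are given, near $(0,0)$, by $$\xi'=\lambda\begin{pmatrix}0&-\frac H2 f(x)\\ Q(x)/f(x)&0\end{pmatrix}\mathrm dx,\qquad \xi''=\lambda^{-1}\begin{pmatrix}0&-R(y)/g(y)\\ \frac H2 g(y)&0\end{pmatrix}\mathrm dy,$$ where $$f(x)=\exp\left\{\omega(x,0)-\tfrac12\omega(0,0)\right\},\qquad g(y)=\exp\left\{\omega(0,y)-\tfrac12\omega(0,0)\right\}.$$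
   Context: $\mathbb E^3_1$ is Minkowski 3-space with metric $\langle\cdot,\cdot\rangle=-\mathrm du_1^2+\mathrm du_2^2+\mathrm du_3^2$. $\mathbb D$ is a simply connected region of $\mathbb R^2(x,y)$ containing the origin. An immersion $\varphi:\mathbb D\to\mathbb E^3_1$ is timelike if its induced metric $I$ is Lorentzian; $(x,y)$ are null coordinates with $I=e^\omega\,\mathrm dx\,\mathrm dy$ (i.e. $\langle\varphi_x,\varphi_x\rangle=\langle\varphi_y,\varphi_y\rangle=0$, $\langle\varphi_x,\varphi_y\rangle=\frac12e^\omega$). With a unit normal field $N$ ($\langle N,N\rangle=1$) put $Q=\langle\varphi_{xx},N\rangle$, $R=\langle\varphi_{yy},N\rangle$, $H=2e^{-\omega}\langle\varphi_{xy},N\rangle$ (the mean curvature). The Gauss–Codazzi equations are $\omega_{xy}+\frac12H^2e^\omega-2QRe^{-\omega}=0$, $H_x=2e^{-\omega}Q_y$, $H_y=2e^{-\omega}R_x$; so if $H$ is constant then $Q=Q(x)$ and $R=R(y)$. Loop groups: $G=\mathrm{SL}(2;\mathbb R)$ and $\sigma$ is conjugation by $\mathbf k'=\mathrm{diag}(-1,1)$. $\Lambda G_\sigma$ is the Banach Lie group of loops $\gamma(\lambda)=\sum_{j\in\mathbb Z}\gamma_j\lambda^j$, $\lambda\in S^1$, with real $2\times2$ coefficients, $\sum_j|\gamma_j|<\infty$, $\det\gamma=1$, $\sigma(\gamma(\lambda))=\gamma(-\lambda)$. $\tilde\Lambda G_\sigma$ is the subgroup of those $\gamma$ extending analytically to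 $\lambda\in\mathbb C^*$, with topology induced from $\Lambda G_\sigma$. $\tilde\Lambda^{+}G_\sigma$ (resp. $\tilde\Lambda^{-}G_\sigma$) consists of elements with only powers $\lambda^j$, $j\ge0$ (resp. $j\le0$); $\tilde\Lambda^{\pm}_*G_\sigma$ consists of those elements of $\tilde\Lambda^\pm G_\sigma$ whose $\lambda^0$-coefficient is $\mathbf 1$. The extended framing of $\varphi$ is the map $\Phi=\Phi_\lambda:\mathbb D\to\tilde\Lambda G_\sigma$ with $\Phi(0,0)=\mathbf 1$ solving $\Phi_x=\Phi U$, $\Phi_y=\Phi V$, where $$U=\begin{pmatrix}\frac14\omega_x&-\lambda\frac H2e^{\omega/2}\\ \lambda Qe^{-\omega/2}&-\frac14\omega_x\end{pmatrix},\qquad V=\begin{pmatrix}-\frac14\omega_y&-\lambda^{-1}Re^{-\omega/2}\\ \lambda^{-1}\frac H2e^{\omega/2}&\frac14\omega_y\end{pmatrix};$$ this system is integrable for every $\lambda$ by the Gauss–Codazzi equations with $H$ constant. On a neighbourhood of $(0,0)$ there are unique (Birkhoff) decompositions $\Phi=\Phi_+L_-=\Phi_-L_+$ with $\Phi_\pm\in\tilde\Lambda^\pm_*G_\sigma$, $L_\pm\in\tilde\Lambda^\pm G_\sigma$. The normalized potentials of $\varphi$ with the origin as reference point are the 1-forms $\xi'=\Phi_+^{-1}\mathrm d\Phi_+$ and $\xi''=\Phi_-^{-1}\mathrm d\Phi_-$. *)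

theory Defs
  imports "HOL-Complex_Analysis.Complex_Analysis"
begin

section \<open>Timelike surfaces in Minkowski 3-space\<close>

definition mink :: "real^3 \<Rightarrow> real^3 \<Rightarrow> real" where
  "mink u v = - (u$1 * v$1) + u$2 * v$2 + u$3 * v$3"

definition pd_x :: "(real \<times> real \<Rightarrow> 'a::real_normed_vector) \<Rightarrow> real \<times> real \<Rightarrow> 'a" where
  "pd_x f p = vector_derivative (\<lambda>t. f (t, snd p)) (at (fst p))"

definition pd_y :: "(real \<times> real \<Rightarrow> 'a::real_normed_vector) \<Rightarrow> real \<times> real \<Rightarrow> 'a" where
  "pd_y f p = vector_derivative (\<lambda>t. f (fst p, t)) (at (snd p))"

text \<open>Meant for open \<open>S\<close>.\<close>

primrec Ck_on :: "nat \<Rightarrow> (real \<times> real) set \<Rightarrow> (real \<times> real \<Rightarrow> 'a::real_normed_vector) \<Rightarrow> bool" where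
  "Ck_on 0 S f \<longleftrightarrow> continuous_on S f"
| "Ck_on (Suc k) S f \<longleftrightarrow> f differentiable_on S \<and> Ck_on k S (pd_x f) \<and> Ck_on k S (pd_y f)"

definition smooth_on :: "(real \<times> real) set \<Rightarrow> (real \<times> real \<Rightarrow> 'a::real_normed_vector) \<Rightarrow> bool" where
  "smooth_on S f \<longleftrightarrow> (\<forall>k. Ck_on k S f)"

definition immersion_on :: "(real \<times> real) set \<Rightarrow> (real \<times> real \<Rightarrow> real^3) \<Rightarrow> bool" where
  "immersion_on D \<phi> \<longleftrightarrow> smooth_on D \<phi> \<and> (\<forall>p\<in>D. inj (frechet_derivative \<phi> (at p)))"

definition induced_metric ::
  "(real \<times> real \<Rightarrow> real^3) \<Rightarrow> real \<times> real \<Rightarrow> real \<times> real \<Rightarrow> real \<times> real \<Rightarrow> real" where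
  "induced_metric \<phi> p v w =
     mink (frechet_derivative \<phi> (at p) v) (frechet_derivative \<phi> (at p) w)"

text \<open>A symmetric bilinear form on a plane is Lorentzian (signature \<open>(1,1)\<close>) iff it takes
  values of both signs on the diagonal.\<close>

definition timelike_on :: "(real \<times> real) set \<Rightarrow> (real \<times> real \<Rightarrow> real^3) \<Rightarrow> bool" where
  "timelike_on D \<phi> \<longleftrightarrow> immersion_on D \<phi> \<and>
     (\<forall>p\<in>D. (\<exists>v. induced_metric \<phi> p v v < 0) \<and> (\<exists>w. induced_metric \<phi> p w w > 0))"

definition null_coordinates ::
  "(real \<times> real) set \<Rightarrow> (real \<times> real \<Rightarrow> real^3) \<Rightarrow> (real \<times> real \<Rightarrow> real) \<Rightarrow> bool" where
  "null_coordinates D \<phi> \<omega> \<longleftrightarrow> smooth_on D \<omega> \<and>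
     (\<forall>p\<in>D. mink (pd_x \<phi> p) (pd_x \<phi> p) = 0 \<and> mink (pd_y \<phi> p) (pd_y \<phi> p) = 0
           \<and> mink (pd_x \<phi> p) (pd_y \<phi> p) = exp (\<omega> p) / 2)"

definition unit_normal_field ::
  "(real \<times> real) set \<Rightarrow> (real \<times> real \<Rightarrow> real^3) \<Rightarrow> (real \<times> real \<Rightarrow> real^3) \<Rightarrow> bool" where
  "unit_normal_field D \<phi> N \<longleftrightarrow> smooth_on D N \<and>
     (\<forall>p\<in>D. mink (N p) (N p) = 1 \<and> mink (pd_x \<phi> p) (N p) = 0 \<and> mink (pd_y \<phi> p) (N p) = 0)"

definition hopf_Q ::
  "(real \<times> real \<Rightarrow> real^3) \<Rightarrow> (real \<times> real \<Rightarrow> real^3) \<Rightarrow> real \<times> real \<Rightarrow> real" where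
  "hopf_Q \<phi> N p = mink (pd_x (pd_x \<phi>) p) (N p)"

definition hopf_R ::
  "(real \<times> real \<Rightarrow> real^3) \<Rightarrow> (real \<times> real \<Rightarrow> real^3) \<Rightarrow> real \<times> real \<Rightarrow> real" where
  "hopf_R \<phi> N p = mink (pd_y (pd_y \<phi>) p) (N p)"

definition mean_curvature ::
  "(real \<times> real \<Rightarrow> real^3) \<Rightarrow> (real \<times> real \<Rightarrow> real^3) \<Rightarrow> (real \<times> real \<Rightarrow> real) \<Rightarrow> real \<times> real \<Rightarrow> real" where
  "mean_curvature \<phi> N \<omega> p = 2 * exp (- \<omega> p) * mink (pd_y (pd_x \<phi>) p) (N p)"


section \<open>Loop groups\<close>

text \<open>A loop \<open>\<gamma>(\<lambda>) = \<Sum>j. \<gamma>\<^sub>j \<lambda>\<^sup>j\<close> with real matrix coefficients is represented by the family of its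
  coefficients, which an absolutely convergent loop determines; \<open>loop_eval \<gamma>\<close> is the associated
  function of \<open>\<lambda>\<close> on the unit circle. Group operations and equations between loops are expressed
  through the values on the circle.\<close>

type_synonym loop = "int \<Rightarrow> real^2^2"

definition loop_eval :: "loop \<Rightarrow> complex \<Rightarrow> complex^2^2" where
  "loop_eval \<gamma> z = (\<chi> i k. \<Sum>\<^sub>\<infinity>j. complex_of_real (\<gamma> j $ i $ k) * z powi j)"

abbreviation unit_circle :: "complex set" where
  "unit_circle \<equiv> sphere 0 1"

definition one_loop :: loop where
  "one_loop j = (if j = 0 then mat 1 else 0)"

definition loop_mult_eq :: "loop \<Rightarrow> loop \<Rightarrow> loop \<Rightarrow> bool" where
  "loop_mult_eq \<gamma> \<alpha> \<beta> \<longleftrightarrow> (\<forall>z\<in>unit_circle. loop_eval \<gamma> z = loop_eval \<alpha> z ** loop_eval \<beta> z)"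

definition kp :: "complex^2^2" where
  "kp = vector [vector [-1, 0], vector [0, 1]]"

definition sigma :: "complex^2^2 \<Rightarrow> complex^2^2" where
  "sigma X = kp ** X ** matrix_inv kp"

definition loop_group :: "loop set" where
  "loop_group = {\<gamma>. (\<lambda>j. norm (\<gamma> j)) summable_on UNIV \<and>
     (\<forall>z\<in>unit_circle. det (loop_eval \<gamma> z) = 1 \<and> sigma (loop_eval \<gamma> z) = loop_eval \<gamma> (- z))}"

definition loop_group_an :: "loop set" where
  "loop_group_an = {\<gamma> \<in> loop_group. \<exists>g :: complex \<Rightarrow> complex^2^2.
     (\<forall>i k. (\<lambda>z. g z $ i $ k) holomorphic_on (- {0})) \<and>
     (\<forall>z\<in>unit_circle. g z = loop_eval \<gamma> z)}"

definition loop_plus :: "loop set" where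
  "loop_plus = {\<gamma> \<in> loop_group_an. \<forall>j<0. \<gamma> j = 0}"

definition loop_minus :: "loop set" where
  "loop_minus = {\<gamma> \<in> loop_group_an. \<forall>j>0. \<gamma> j = 0}"

definition loop_plus_star :: "loop set" where
  "loop_plus_star = {\<gamma> \<in> loop_plus. \<gamma> 0 = mat 1}"

definition loop_minus_star :: "loop set" where
  "loop_minus_star = {\<gamma> \<in> loop_minus. \<gamma> 0 = mat 1}"


section \<open>Extended framings and normalized potentials\<close>

definition framing_U ::
  "real \<Rightarrow> (real \<times> real \<Rightarrow> real) \<Rightarrow> (real \<times> real \<Rightarrow> real) \<Rightarrow> complex \<Rightarrow> real \<times> real \<Rightarrow> complex^2^2" where
  "framing_U H \<omega> Q z p = vector
     [vector [of_real (pd_x \<omega> p / 4),             - z * of_real (H / 2 * exp (\<omega> p / 2))],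
      vector [z * of_real (Q p * exp (- \<omega> p / 2)), of_real (- pd_x \<omega> p / 4)]]"

definition framing_V ::
  "real \<Rightarrow> (real \<times> real \<Rightarrow> real) \<Rightarrow> (real \<times> real \<Rightarrow> real) \<Rightarrow> complex \<Rightarrow> real \<times> real \<Rightarrow> complex^2^2" where
  "framing_V H \<omega> R z p = vector
     [vector [of_real (- pd_y \<omega> p / 4),                 - inverse z * of_real (R p * exp (- \<omega> p / 2))],
      vector [inverse z * of_real (H / 2 * exp (\<omega> p / 2)), of_real (pd_y \<omega> p / 4)]]"

definition extended_framing ::
  "(real \<times> real) set \<Rightarrow> (real \<times> real \<Rightarrow> real^3) \<Rightarrow> (real \<times> real \<Rightarrow> real^3) \<Rightarrow> (real \<times> real \<Rightarrow> real) \<Rightarrow> real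
     \<Rightarrow> (real \<times> real \<Rightarrow> loop) \<Rightarrow> bool" where
  "extended_framing D \<phi> N \<omega> H \<Phi> \<longleftrightarrow>
     \<Phi> (0, 0) = one_loop \<and> (\<forall>p\<in>D. \<Phi> p \<in> loop_group_an) \<and>
     (\<forall>x y. (x, y) \<in> D \<longrightarrow> (\<forall>z\<in>unit_circle.
        ((\<lambda>t. loop_eval (\<Phi> (t, y)) z) has_vector_derivative
           loop_eval (\<Phi> (x, y)) z ** framing_U H \<omega> (hopf_Q \<phi> N) z (x, y)) (at x) \<and>
        ((\<lambda>t. loop_eval (\<Phi> (x, t)) z) has_vector_derivative
           loop_eval (\<Phi> (x, y)) z ** framing_V H \<omega> (hopf_R \<phi> N) z (x, y)) (at y)))"

definition birkhoff_pm :: "loop \<Rightarrow> loop \<times> loop \<Rightarrow> bool" where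
  "birkhoff_pm \<gamma> P \<longleftrightarrow>
     fst P \<in> loop_plus_star \<and> snd P \<in> loop_minus \<and> loop_mult_eq \<gamma> (fst P) (snd P)"

definition birkhoff_mp :: "loop \<Rightarrow> loop \<times> loop \<Rightarrow> bool" where
  "birkhoff_mp \<gamma> P \<longleftrightarrow>
     fst P \<in> loop_minus_star \<and> snd P \<in> loop_plus \<and> loop_mult_eq \<gamma> (fst P) (snd P)"

text \<open>The two factors below are meaningful only where the decomposition exists uniquely.\<close>

definition plus_factor :: "loop \<Rightarrow> loop" where
  "plus_factor \<gamma> = fst (THE P. birkhoff_pm \<gamma> P)"

definition minus_factor :: "loop \<Rightarrow> loop" where
  "minus_factor \<gamma> = fst (THE P. birkhoff_mp \<gamma> P)"

text \<open>The 1-form \<open>F\<^sup>-\<^sup>1 dF\<close> at the point \<open>p\<close>, the loop parameter \<open>z\<close> and the tangent vector \<open>v\<close>.\<close>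

definition maurer_cartan ::
  "(real \<times> real \<Rightarrow> loop) \<Rightarrow> complex \<Rightarrow> real \<times> real \<Rightarrow> real \<times> real \<Rightarrow> complex^2^2" where
  "maurer_cartan F z p v =
     matrix_inv (loop_eval (F p) z) ** frechet_derivative (\<lambda>q. loop_eval (F q) z) (at p) v"

definition normalized_potential_x ::
  "(real \<times> real \<Rightarrow> loop) \<Rightarrow> complex \<Rightarrow> real \<times> real \<Rightarrow> real \<times> real \<Rightarrow> complex^2^2" where
  "normalized_potential_x \<Phi> = maurer_cartan (\<lambda>p. plus_factor (\<Phi> p))"

definition normalized_potential_y ::
  "(real \<times> real \<Rightarrow> loop) \<Rightarrow> complex \<Rightarrow> real \<times> real \<Rightarrow> real \<times> real \<Rightarrow> complex^2^2" where
  "normalized_potential_y \<Phi> = maurer_cartan (\<lambda>p. minus_factor (\<Phi> p))"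

end

theory Submission
  imports Defs
begin

text \<open>
  Along the \<open>x\<close>-axis the matrix \<open>U\<close> is the sum of a diagonal term free of \<open>\<lambda>\<close> and an off-diagonal
  multiple of \<open>\<lambda>\<close>. With the gauge \<open>a(x) = diag(e\<^sup>h, e\<^sup>-\<^sup>h)\<close>, \<open>h = (\<omega>(x,0) - \<omega>(0,0))/4\<close>, the loop
  \<open>Y(x) = \<Phi>(x,0) a(x)\<^sup>-\<^sup>1\<close> solves \<open>Y' = \<lambda> Y A\<close>, where \<open>\<lambda> A dx\<close> is the claimed potential; so \<open>Y\<close> is a
  power series in \<open>\<lambda>\<close> with iterated integrals as coefficients and constant term \<open>1\<close>. Since \<open>V\<close> involves
  only nonpositive powers of \<open>\<lambda>\<close>, the same argument along vertical segments shows
  \<open>\<Phi>(x,0)\<^sup>-\<^sup>1 \<Phi>(x,y) \<in> \<Lambda>\<^sup>-\<close>. Hence \<open>\<Phi>(x,y) = Y(x) \<cdot> (a(x) \<Phi>(x,0)\<^sup>-\<^sup>1 \<Phi>(x,y))\<close> is already a Birkhoff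
  decomposition, which is unique by comparison of Fourier coefficients: \<open>\<Phi>\<^sub>+(x,y) = Y(x)\<close>. The
  substitution \<open>\<lambda> \<mapsto> \<lambda>\<^sup>-\<^sup>1\<close> together with exchanging \<open>x\<close> and \<open>y\<close> turns \<open>\<Phi>\<^sub>-\<close> into the same situation.
\<close>

no_notation fps_nth (infixl \<open>$\<close> 75)

section \<open>Absolutely convergent Fourier series\<close>

text \<open>Orthogonality of the characters of the circle: integrating against one of them isolates
  a single Fourier coefficient.\<close>

lemma has_integral_cis:
  "((\<lambda>t. cis (of_int k * t)) has_integral (if k = 0 then 2 * pi else 0)) {0..2 * pi}"
proof (cases "k = 0")
  case True
  then show ?thesis
    using has_integral_const_real[of "1 :: complex" 0 "2 * pi"]
    by (simp add: scaleR_conv_of_real)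
next
  case False
  let ?F = "\<lambda>t. cis (of_int k * t) / (\<i> * of_int k)"
  have "((\<lambda>t. cis (of_int k * t)) has_integral (?F (2 * pi) - ?F 0)) {0..2 * pi}"
  proof (rule fundamental_theorem_of_calculus)
    fix t :: real
    have "((\<lambda>w. exp (\<i> * of_int k * w) / (\<i> * of_int k)) has_field_derivative
        exp (\<i> * of_int k * of_real t)) (at (of_real t))"
      using False by (auto intro!: derivative_eq_intros)
    from has_vector_derivative_real_field[OF this]
    show "(?F has_vector_derivative cis (of_int k * t)) (at t within {0..2 * pi})"
      by (simp add: cis_conv_exp mult_ac)
  qed simp
  moreover have "cis (of_int k * (2 * pi)) = 1"
    using cis_multiple_2pi[of "of_int k"] by (simp add: mult_ac)
  ultimately show ?thesis
    using False by simp
qed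

text \<open>An interchange of infinite sum and integral is avoided: outside a finite index set the
  coefficients have total size at most \<open>e\<close>, so the remaining trigonometric polynomial
  is at most \<open>e\<close> on the whole circle, and integration against a character bounds its
  coefficient of index \<open>m\<close> by \<open>e\<close>.\<close>

lemma fourier_unique:
  fixes a :: "int \<Rightarrow> complex"
  assumes sm: "(\<lambda>j. norm (a j)) summable_on UNIV"
    and z: "\<And>z. z \<in> unit_circle \<Longrightarrow> (\<Sum>\<^sub>\<infinity>j. a j * z powi j) = 0"
  shows "a m = 0"
proof -
  have "norm (a m) \<le> e" if e: "e > 0" for e
  proof -
    obtain F0 where F0: "finite F0"
      and F0d: "dist (\<Sum>j\<in>F0. norm (a j)) (\<Sum>\<^sub>\<infinity>j. norm (a j)) \<le> e"
      using infsum_finite_approximation[OF sm e] by auto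
    \<comment> \<open>\<open>m\<close> is inserted so that the polynomial contains the coefficient
      to be extracted; enlarging \<open>F0\<close> can only shrink the tail.\<close>
    define F where "F = insert m F0"
    have F: "finite F" "m \<in> F"
      using F0 by (auto simp: F_def)
    have smF: "(\<lambda>j. norm (a j)) summable_on (- F)"
      using sm by (rule summable_on_subset_banach) auto
    have "(\<Sum>j\<in>F0. norm (a j)) \<le> (\<Sum>j\<in>F. norm (a j))"
      using F0 by (intro sum_mono2) (auto simp: F_def)
    moreover have "(\<Sum>\<^sub>\<infinity>j. norm (a j)) = (\<Sum>j\<in>F. norm (a j)) + (\<Sum>\<^sub>\<infinity>j\<in>-F. norm (a j))"
      using infsum_Un_disjoint[of "\<lambda>j. norm (a j)" F "- F"] F smF
      by (simp add: summable_on_finite Compl_partition)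
    ultimately have tail: "(\<Sum>\<^sub>\<infinity>j\<in>-F. norm (a j)) \<le> e"
      using F0d by (simp add: dist_real_def)
    have bound: "norm (\<Sum>j\<in>F. a j * z powi j) \<le> e" if zc: "z \<in> unit_circle" for z
    proof -
      have nz: "norm (a j * z powi j) = norm (a j)" for j
        using zc by (simp add: norm_mult norm_power_int)
      have s: "(\<lambda>j. norm (a j * z powi j)) summable_on (- F)"
        using smF by (simp add: nz)
      have "(\<Sum>\<^sub>\<infinity>j. a j * z powi j) = (\<Sum>j\<in>F. a j * z powi j) + (\<Sum>\<^sub>\<infinity>j\<in>-F. a j * z powi j)"
        using infsum_Un_disjoint[of "\<lambda>j. a j * z powi j" F "- F"] F abs_summable_summable[OF s]
        by (simp add: summable_on_finite Compl_partition)
      then have "norm (\<Sum>j\<in>F. a j * z powi j) = norm (\<Sum>\<^sub>\<infinity>j\<in>-F. a j * z powi j)"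
        using z[OF zc] by (metis add_eq_0_iff norm_minus_cancel)
      also have "\<dots> \<le> (\<Sum>\<^sub>\<infinity>j\<in>-F. norm (a j * z powi j))"
        by (rule norm_infsum_bound[OF s])
      also have "\<dots> \<le> e"
        using tail by (simp add: nz)
      finally show ?thesis .
    qed
    have cisp: "cis t powi j = cis (of_int j * t)" for t :: real and j
      by (simp add: power_int_def Complex.DeMoivre cis_inverse flip: of_nat_nat)
         (simp add: cis_inverse Complex.DeMoivre)
    have "((\<lambda>t. \<Sum>j\<in>F. a j * cis (of_int (j - m) * t)) has_integral
        (\<Sum>j\<in>F. a j * (if j - m = 0 then 2 * pi else 0))) {0..2 * pi}"
      by (intro has_integral_sum F has_integral_mult_right has_integral_cis)
    also have "(\<Sum>j\<in>F. a j * (if j - m = 0 then 2 * pi else 0))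
        = (\<Sum>j\<in>F. if j = m then a m * (2 * pi) else 0)"
      by (intro sum.cong) auto
    also have "\<dots> = a m * (2 * pi)"
      using F by simp
    finally have int: "((\<lambda>t. \<Sum>j\<in>F. a j * cis (of_int (j - m) * t)) has_integral
        (a m * (2 * pi))) {0..2 * pi}" .
    \<comment> \<open>Shifting all frequencies by \<open>- m\<close> is multiplication by a
      unimodular number, so the bound on the polynomial survives.\<close>
    have nb: "norm (\<Sum>j\<in>F. a j * cis (of_int (j - m) * t)) \<le> e" for t
    proof -
      have "(\<Sum>j\<in>F. a j * cis (of_int (j - m) * t)) = (\<Sum>j\<in>F. a j * cis t powi j) * cis (- of_int m * t)"
        unfolding sum_distrib_right cisp by (intro sum.cong) (auto simp: cis_mult algebra_simps)
      also have "norm \<dots> \<le> e"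
        using bound[of "cis t"] by (simp add: norm_mult)
      finally show ?thesis .
    qed
    have "norm (a m * (2 * pi)) \<le> e * (2 * pi)"
      using has_integral_bound_real[OF _ _ int, of e "{}"] e nb by (simp add: less_imp_le)
    then show ?thesis
      by (simp add: norm_mult)
  qed
  then have "norm (a m) \<le> 0"
    by (meson dense_ge)
  then show ?thesis
    by simp
qed

text \<open>Power series are indexed by naturals and loops by integers; \<open>int\<close> carries
  the former to the latter, with zeros at the negative indices.\<close>

lemma has_sum_power_int:
  fixes c :: "nat \<Rightarrow> complex"
  assumes "summable (\<lambda>n. norm (c n))" and "norm z = 1"
  shows "((\<lambda>j. (if 0 \<le> j then c (nat j) else 0) * z powi j) has_sum (\<Sum>n. c n * z ^ n)) UNIV"
proof -
  have s: "summable (\<lambda>n. norm (c n * z ^ n))"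
    using assms by (simp add: norm_mult norm_power)
  have "((\<lambda>n. c n * z ^ n) has_sum (\<Sum>n. c n * z ^ n)) UNIV"
    using norm_summable_imp_has_sum[OF s] summable_norm_cancel[OF s] summable_sums by blast
  then have "((\<lambda>j. (if 0 \<le> j then c (nat j) else 0) * z powi j) has_sum (\<Sum>n. c n * z ^ n)) (range int)"
    by (subst has_sum_reindex) (auto simp: o_def)
  then show ?thesis
    by (rule has_sum_cong_neutral[THEN iffD1, rotated -1])
      (auto simp: image_iff intro: nonneg_int_cases)
qed

lemma summable_power_int:
  fixes c :: "nat \<Rightarrow> 'a::banach"
  assumes "summable (\<lambda>n. norm (c n))"
  shows "(\<lambda>j. norm (if 0 \<le> j then c (nat j) else 0)) summable_on (UNIV :: int set)"
proof -
  have "(\<lambda>n. norm (c n)) summable_on UNIV"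
    using assms by (intro norm_summable_imp_summable_on) simp
  then have "(\<lambda>j. norm (if 0 \<le> j then c (nat j) else 0)) summable_on (range int)"
    by (subst summable_on_reindex) (auto simp: o_def)
  then show ?thesis
    by (rule summable_on_cong_neutral[THEN iffD1, rotated -1])
      (auto simp: image_iff intro: nonneg_int_cases)
qed

lemma has_sum_uminus_int:
  fixes f :: "int \<Rightarrow> 'a::{comm_monoid_add,topological_space}"
  shows "((\<lambda>j. f (- j)) has_sum s) UNIV \<longleftrightarrow> (f has_sum s) UNIV"
  by (rule has_sum_reindex_bij_betw[where g = uminus]) (simp add: involuntory_imp_bij)

text \<open>Comparison of Fourier coefficients takes the place of Liouville's theorem: the
  frequencies are nonnegative on one side and nonpositive on the other, so only frequency zero
  survives.\<close>

lemma one_sided_series_constant: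
  fixes a b :: "nat \<Rightarrow> complex"
  assumes a: "summable (\<lambda>n. norm (a n))" and b: "summable (\<lambda>n. norm (b n))"
    and eq: "\<And>z. z \<in> unit_circle \<Longrightarrow> (\<Sum>n. a n * z ^ n) = (\<Sum>n. b n * inverse z ^ n)"
    and z: "z \<in> unit_circle"
  shows "(\<Sum>n. a n * z ^ n) = a 0"
proof -
  define A where "A j = (if 0 \<le> j then a (nat j) else 0)" for j :: int
  define B where "B j = (if 0 \<le> j then b (nat j) else 0)" for j :: int
  have hA: "((\<lambda>j. A j * z powi j) has_sum (\<Sum>n. a n * z ^ n)) UNIV" if "z \<in> unit_circle" for z
    unfolding A_def using that by (intro has_sum_power_int a) auto
  have hB: "((\<lambda>j. B (- j) * z powi j) has_sum (\<Sum>n. b n * inverse z ^ n)) UNIV"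
    if "z \<in> unit_circle" for z
  proof -
    have "((\<lambda>j. B j * inverse z powi j) has_sum (\<Sum>n. b n * inverse z ^ n)) UNIV"
      unfolding B_def using that by (intro has_sum_power_int b) (auto simp: norm_inverse)
    then have "((\<lambda>j. B (- j) * inverse z powi (- j)) has_sum (\<Sum>n. b n * inverse z ^ n)) UNIV"
      using has_sum_uminus_int[of "\<lambda>j. B j * inverse z powi j"] by blast
    then show ?thesis
      by (simp add: power_int_minus power_int_inverse)
  qed
  have sA: "(\<lambda>j. norm (A j)) summable_on UNIV"
    unfolding A_def by (rule summable_power_int[OF a])
  have sB: "(\<lambda>j. norm (B (- j))) summable_on UNIV"
  proof -
    have "(\<lambda>j. norm (B j)) summable_on UNIV"
      unfolding B_def by (rule summable_power_int[OF b])
    then show ?thesis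
      using has_sum_uminus_int[of "\<lambda>j. norm (B j)"] unfolding summable_on_def by blast
  qed
  have AB: "A j - B (- j) = 0" for j
  proof (rule fourier_unique[of "\<lambda>j. A j - B (- j)"])
    show "(\<lambda>j. norm (A j - B (- j))) summable_on UNIV"
      by (rule Infinite_Sum.abs_summable_on_comparison_test'[OF summable_on_add[OF sA sB]])
        (rule norm_triangle_ineq4)
  next
    fix z :: complex assume z: "z \<in> unit_circle"
    have "((\<lambda>j. A j * z powi j - B (- j) * z powi j) has_sum
        ((\<Sum>n. a n * z ^ n) - (\<Sum>n. b n * inverse z ^ n))) UNIV"
      using has_sum_add[OF hA[OF z] has_sum_cmult_right[OF hB[OF z], of "- 1"]] by simp
    then show "(\<Sum>\<^sub>\<infinity>j. (A j - B (- j)) * z powi j) = 0"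
      using eq[OF z] by (auto simp: algebra_simps dest: infsumI)
  qed
  \<comment> \<open>At a positive index, \<open>B\<close> is read at a negative argument, where it
    is zero by construction.\<close>
  have "a n = 0" if "n \<noteq> 0" for n
    using AB[of "int n"] that by (simp add: A_def B_def)
  then have "(\<Sum>n. a n * z ^ n) = (\<Sum>n\<in>{0}. a n * z ^ n)"
    by (intro suminf_finite) auto
  then show ?thesis by simp
qed

section \<open>Functions on the circle with nonnegative frequencies\<close>

text \<open>The half of the Wiener algebra with nonnegative frequencies. The constant coefficient
  \<open>c\<close>, the value at the centre of the disc, is carried along because it decides which
  constant the comparison of two one-sided series produces.\<close>

definition power_series_on_circle :: "(complex \<Rightarrow> complex) \<Rightarrow> complex \<Rightarrow> bool" where
  "power_series_on_circle f c \<longleftrightarrow> (\<exists>a. summable (\<lambda>n. norm (a n)) \<and> a 0 = c \<and>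
     (\<forall>z\<in>unit_circle. f z = (\<Sum>n. a n * z ^ n)))"

lemma power_series_on_circle_diff:
  assumes "power_series_on_circle f c" and "power_series_on_circle g d"
  shows "power_series_on_circle (\<lambda>z. f z - g z) (c - d)"
proof -
  obtain a b where a: "summable (\<lambda>n. norm (a n))" "a 0 = c" "\<forall>z\<in>unit_circle. f z = (\<Sum>n. a n * z ^ n)"
    and b: "summable (\<lambda>n. norm (b n))" "b 0 = d" "\<forall>z\<in>unit_circle. g z = (\<Sum>n. b n * z ^ n)"
    using assms unfolding power_series_on_circle_def by blast
  have s: "summable (\<lambda>n. c n * z ^ n)" if "summable (\<lambda>n. norm (c n))" "z \<in> unit_circle" for c :: "nat \<Rightarrow> complex" and z
    using that by (intro summable_norm_cancel[of "\<lambda>n. c n * z ^ n"]) (simp add: norm_mult norm_power)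
  have "summable (\<lambda>n. norm (a n - b n))"
    by (rule summable_comparison_test'[OF summable_add[OF a(1) b(1)], of 0])
      (auto intro: norm_triangle_ineq4)
  then show ?thesis
    unfolding power_series_on_circle_def
    by (intro exI[of _ "\<lambda>n. a n - b n"])
      (auto simp: a b left_diff_distrib suminf_diff s)
qed

lemma power_series_on_circle_mult:
  assumes "power_series_on_circle f c" and "power_series_on_circle g d"
  shows "power_series_on_circle (\<lambda>z. f z * g z) (c * d)"
proof -
  obtain a b where a: "summable (\<lambda>n. norm (a n))" "a 0 = c" "\<forall>z\<in>unit_circle. f z = (\<Sum>n. a n * z ^ n)"
    and b: "summable (\<lambda>n. norm (b n))" "b 0 = d" "\<forall>z\<in>unit_circle. g z = (\<Sum>n. b n * z ^ n)"
    using assms unfolding power_series_on_circle_def by blast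
  define e where "e n = (\<Sum>i\<le>n. a i * b (n - i))" for n
  have "summable (\<lambda>n. norm (e n))"
  proof (rule summable_comparison_test')
    show "summable (\<lambda>n. \<Sum>i\<le>n. norm (a i) * norm (b (n - i)))"
      using summable_Cauchy_product[of "\<lambda>n. norm (a n)" "\<lambda>n. norm (b n)"] a b by simp
    show "norm (norm (e n)) \<le> (\<Sum>i\<le>n. norm (a i) * norm (b (n - i)))" if "n \<ge> 0" for n
      unfolding e_def by (simp add: norm_mult sum_norm_le)
  qed
  moreover have "f z * g z = (\<Sum>n. e n * z ^ n)" if z: "z \<in> unit_circle" for z
  proof -
    have s: "summable (\<lambda>n. norm (a n * z ^ n))" "summable (\<lambda>n. norm (b n * z ^ n))"
      using z a b by (simp_all add: norm_mult norm_power)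
    have "f z * g z = (\<Sum>n. \<Sum>i\<le>n. (a i * z ^ i) * (b (n - i) * z ^ (n - i)))"
      using Cauchy_product[OF s] a b z by simp
    also have "(\<lambda>n. \<Sum>i\<le>n. (a i * z ^ i) * (b (n - i) * z ^ (n - i))) = (\<lambda>n. e n * z ^ n)"
      unfolding e_def sum_distrib_right
      by (intro ext sum.cong refl) (simp add: mult_ac flip: power_add)
    finally show ?thesis .
  qed
  ultimately show ?thesis
    unfolding power_series_on_circle_def using a b
    by (intro exI[of _ e]) (auto simp: e_def)
qed

text \<open>Since \<open>g\<close> is evaluated at \<open>inverse z\<close>, the hypothesis
  \<open>eq\<close> says that \<open>f\<close> also has an expansion in nonpositive powers.\<close>

lemma power_series_on_circle_constant:
  assumes "power_series_on_circle f c" and "power_series_on_circle g d"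
    and eq: "\<And>z. z \<in> unit_circle \<Longrightarrow> f z = g (inverse z)" and z: "z \<in> unit_circle"
  shows "f z = c"
proof -
  obtain a b where a: "summable (\<lambda>n. norm (a n))" "a 0 = c" "\<forall>z\<in>unit_circle. f z = (\<Sum>n. a n * z ^ n)"
    and b: "summable (\<lambda>n. norm (b n))" "b 0 = d" "\<forall>z\<in>unit_circle. g z = (\<Sum>n. b n * z ^ n)"
    using assms(1,2) unfolding power_series_on_circle_def by blast
  have "(\<Sum>n. a n * z ^ n) = a 0"
  proof (rule one_sided_series_constant[OF a(1) b(1) _ z])
    fix z :: complex assume "z \<in> unit_circle"
    then show "(\<Sum>n. a n * z ^ n) = (\<Sum>n. b n * inverse z ^ n)"
      using eq[of z] a(3) b(3) by (simp add: norm_inverse)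
  qed
  then show ?thesis
    using a z by simp
qed

section \<open>Two by two matrices\<close>

lemma norm_entry_le: "norm (A $ i $ k) \<le> norm (A :: 'a::real_normed_vector^'n^'m)"
  using Finite_Cartesian_Product.norm_nth_le[of "A $ i" k] Finite_Cartesian_Product.norm_nth_le[of A i]
  by linarith

lemma matrix2_eq_iff:
  "A = (B :: 'a^2^2) \<longleftrightarrow> A$1$1 = B$1$1 \<and> A$1$2 = B$1$2 \<and> A$2$1 = B$2$1 \<and> A$2$2 = B$2$2"
  by (auto simp: vec_eq_iff forall_2)

lemma matrix2_mult_nth: "(A ** B) $ i $ k = A$i$1 * B$1$k + A$i$2 * (B :: 'a::semiring_1^2^2)$2$k"
  by (simp add: matrix_matrix_mult_def sum_2)

lemma mat_nth: "mat c $ i $ k = (if i = k then c else 0)"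
  by (simp add: mat_def)

text \<open>At determinant one the adjugate is the inverse. Its entries are signed entries of the
  matrix, so inverting a one-sided loop leaves it one-sided.\<close>

definition adj2 :: "'a::comm_ring_1^2^2 \<Rightarrow> 'a^2^2" where
  "adj2 A = vector [vector [A$2$2, - A$1$2], vector [- A$2$1, A$1$1]]"

lemma adj2_nth [simp]:
  "adj2 A $ 1 $ 1 = A$2$2" "adj2 A $ 1 $ 2 = - A$1$2"
  "adj2 A $ 2 $ 1 = - A$2$1" "adj2 A $ 2 $ 2 = A$1$1"
  by (simp_all add: adj2_def)

lemma adj2_inverse:
  assumes "det A = 1"
  shows "A ** adj2 A = mat 1" and "adj2 A ** A = mat 1"
  using assms by (simp_all add: matrix2_eq_iff matrix2_mult_nth mat_nth det_2 algebra_simps)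

lemma matrix_inv_eqI:
  assumes "A ** B = mat 1" and "B ** A = mat 1"
  shows "matrix_inv A = B"
proof -
  have "A ** matrix_inv A = mat 1 \<and> matrix_inv A ** A = mat 1"
    unfolding matrix_inv_def by (rule someI[of _ B]) (use assms in simp)
  then show ?thesis
    using assms by (metis matrix_mul_assoc matrix_mul_lid matrix_mul_rid)
qed

lemma matrix_inv_cancel:
  fixes A B :: "complex^2^2"
  assumes "det A = 1"
  shows "matrix_inv A ** (A ** B) = B"
  by (simp add: matrix_inv_eqI[OF adj2_inverse[OF assms]] matrix_mul_assoc adj2_inverse[OF assms])

text \<open>Conjugation by \<open>kp\<close> changes the off-diagonal signs, so a twisted loop is
  one with diagonal entries even and off-diagonal entries odd in \<lambda>.\<close>

lemma sigma_nth: "sigma X $ i $ k = (if i = k then X $ i $ k else - X $ i $ k)"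
proof -
  have "kp ** kp = mat 1"
    by (simp add: kp_def matrix2_eq_iff matrix2_mult_nth mat_nth)
  then have "matrix_inv kp = kp"
    by (simp add: matrix_inv_eqI)
  then have "\<forall>i k. sigma X $ i $ k = (if i = k then X $ i $ k else - X $ i $ k)"
    unfolding forall_2 by (simp add: sigma_def kp_def matrix2_mult_nth)
  then show ?thesis by blast
qed

section \<open>Loops and uniqueness of the Birkhoff decomposition\<close>

lemma loop_eval_nth:
  "loop_eval \<gamma> z $ i $ k = (\<Sum>\<^sub>\<infinity>j. complex_of_real (\<gamma> j $ i $ k) * z powi j)"
  by (simp add: loop_eval_def)

lemma loop_group_summable: "\<gamma> \<in> loop_group \<Longrightarrow> (\<lambda>j. norm (\<gamma> j)) summable_on UNIV"
  by (simp add: loop_group_def)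

lemma loop_group_det: "\<gamma> \<in> loop_group \<Longrightarrow> z \<in> unit_circle \<Longrightarrow> det (loop_eval \<gamma> z) = 1"
  by (simp add: loop_group_def)

lemma loop_group_an_subset: "\<gamma> \<in> loop_group_an \<Longrightarrow> \<gamma> \<in> loop_group"
  by (simp add: loop_group_an_def)

lemma loop_plus_subset: "\<gamma> \<in> loop_plus \<Longrightarrow> \<gamma> \<in> loop_group"
  by (simp add: loop_plus_def loop_group_an_def)

lemma loop_minus_subset: "\<gamma> \<in> loop_minus \<Longrightarrow> \<gamma> \<in> loop_group"
  by (simp add: loop_minus_def loop_group_an_def)

lemma loop_entry_summable:
  fixes \<gamma> :: loop
  assumes "(\<lambda>j. norm (\<gamma> j)) summable_on A"
  shows "(\<lambda>j. norm (complex_of_real (\<gamma> j $ i $ k))) summable_on A"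
  using norm_entry_le[of "\<gamma> _" i k]
  by (intro Infinite_Sum.abs_summable_on_comparison_test'[OF assms]) simp

lemma loop_eval_has_sum:
  assumes "(\<lambda>j. norm (\<gamma> j)) summable_on UNIV" and "z \<in> unit_circle"
  shows "((\<lambda>j. complex_of_real (\<gamma> j $ i $ k) * z powi j) has_sum loop_eval \<gamma> z $ i $ k) UNIV"
proof -
  have "(\<lambda>j. norm (complex_of_real (\<gamma> j $ i $ k) * z powi j)) summable_on UNIV"
    using loop_entry_summable[OF assms(1), of i k] assms(2) by (simp add: norm_mult norm_power_int)
  then show ?thesis
    unfolding loop_eval_nth by (intro has_sum_infsum) (rule abs_summable_summable)
qed

text \<open>Products of loops are compared through their values on the circle only. This turns such
  equalities into equality of the coefficient families, which is what the definite descriptions of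
  the Birkhoff factors require.\<close>

lemma loop_eval_inject:
  assumes s: "(\<lambda>j. norm (\<gamma> j)) summable_on UNIV" "(\<lambda>j. norm (\<delta> j)) summable_on UNIV"
    and eq: "\<And>z. z \<in> unit_circle \<Longrightarrow> loop_eval \<gamma> z = loop_eval \<delta> z"
  shows "\<gamma> = \<delta>"
proof -
  have "complex_of_real (\<gamma> j $ i $ k - \<delta> j $ i $ k) = 0" for i k j
  proof (rule fourier_unique[of "\<lambda>j. complex_of_real (\<gamma> j $ i $ k - \<delta> j $ i $ k)"])
    show "(\<lambda>j. norm (complex_of_real (\<gamma> j $ i $ k - \<delta> j $ i $ k))) summable_on UNIV"
      by (rule Infinite_Sum.abs_summable_on_comparison_test'
            [OF summable_on_add[OF s[THEN loop_entry_summable, of i k]]])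
        (unfold of_real_diff, rule norm_triangle_ineq4)
    fix z :: complex assume z: "z \<in> unit_circle"
    have "((\<lambda>j. complex_of_real (\<gamma> j $ i $ k - \<delta> j $ i $ k) * z powi j) has_sum 0) UNIV"
      using has_sum_add[OF loop_eval_has_sum[OF s(1) z, of i k]
          has_sum_cmult_right[OF loop_eval_has_sum[OF s(2) z, of i k], of "- 1"]] eq[OF z]
      by (simp add: algebra_simps)
    then show "(\<Sum>\<^sub>\<infinity>j. complex_of_real (\<gamma> j $ i $ k - \<delta> j $ i $ k) * z powi j) = 0"
      by (rule infsumI)
  qed
  then show ?thesis
    by (simp add: fun_eq_iff vec_eq_iff)
qed

section \<open>Loops given by power series\<close>

definition power_loop :: "(nat \<Rightarrow> real^2^2) \<Rightarrow> loop" where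
  "power_loop C j = (if 0 \<le> j then C (nat j) else 0)"

lemma loop_eval_power_loop:
  assumes "summable (\<lambda>n. norm (C n))" and "z \<in> unit_circle"
  shows "loop_eval (power_loop C) z $ i $ k = (\<Sum>n. of_real (C n $ i $ k) * z ^ n)"
proof -
  have "summable (\<lambda>n. norm (complex_of_real (C n $ i $ k)))"
    by (rule summable_comparison_test'[OF assms(1), of 0]) (use norm_entry_le[of "C _" i k] in simp)
  moreover have "norm z = 1"
    using assms(2) by simp
  ultimately have "((\<lambda>j. (if 0 \<le> j then complex_of_real (C (nat j) $ i $ k) else 0) * z powi j) has_sum
      (\<Sum>n. of_real (C n $ i $ k) * z ^ n)) UNIV"
    by (rule has_sum_power_int)
  moreover have "complex_of_real (power_loop C j $ i $ k) =
      (if 0 \<le> j then complex_of_real (C (nat j) $ i $ k) else 0)" for j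
    by (simp add: power_loop_def)
  ultimately show ?thesis
    by (simp only: loop_eval_nth infsumI)
qed

lemma loop_plus_power_series:
  assumes "\<gamma> \<in> loop_plus"
  shows "power_series_on_circle (\<lambda>z. loop_eval \<gamma> z $ i $ k) (of_real (\<gamma> 0 $ i $ k))"
proof -
  define C where "C n = \<gamma> (int n)" for n
  have \<gamma>: "\<gamma> = power_loop C"
    using assms by (auto simp: power_loop_def C_def loop_plus_def)
  have "(\<lambda>j. norm (\<gamma> j)) summable_on (range int)"
    using loop_group_summable[OF loop_plus_subset[OF assms]]
    by (rule summable_on_subset_banach) auto
  then have "(\<lambda>n. norm (C n)) summable_on UNIV"
    by (subst (asm) summable_on_reindex) (auto simp: o_def C_def)
  then have s: "summable (\<lambda>n. norm (C n))"
    by (rule summable_on_imp_summable)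
  have "summable (\<lambda>n. norm (complex_of_real (C n $ i $ k)))"
    by (rule summable_comparison_test'[OF s, of 0]) (use norm_entry_le[of "C _" i k] in simp)
  then show ?thesis
    unfolding power_series_on_circle_def using s
    by (intro exI[of _ "\<lambda>n. complex_of_real (C n $ i $ k)"])
      (simp add: \<gamma> loop_eval_power_loop power_loop_def)
qed

section \<open>Inversion of the loop parameter\<close>

text \<open>Inversion of \<lambda>, acting on coefficients. It exchanges the plus and the minus
  group, so both decompositions reduce to a single one.\<close>

definition loop_reflect :: "loop \<Rightarrow> loop" where
  "loop_reflect \<gamma> j = \<gamma> (- j)"

lemma loop_reflect_reflect [simp]: "loop_reflect (loop_reflect \<gamma>) = \<gamma>"
  by (simp add: loop_reflect_def fun_eq_iff)

lemma loop_eval_reflect: "loop_eval (loop_reflect \<gamma>) z = loop_eval \<gamma> (inverse z)"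
proof -
  have "(\<Sum>\<^sub>\<infinity>j. complex_of_real (\<gamma> (- j) $ i $ k) * z powi j) =
      (\<Sum>\<^sub>\<infinity>j. complex_of_real (\<gamma> j $ i $ k) * inverse z powi j)" for i k
    using infsum_reindex_bij_betw[of uminus UNIV UNIV
        "\<lambda>j. complex_of_real (\<gamma> (- j) $ i $ k) * z powi j"]
    by (simp add: involuntory_imp_bij power_int_minus power_int_inverse)
  then show ?thesis
    by (simp add: vec_eq_iff loop_eval_nth loop_reflect_def)
qed

lemma inverse_unit_circle: "inverse z \<in> unit_circle \<longleftrightarrow> z \<in> unit_circle"
  by (simp add: norm_inverse)

lemma loop_reflect_groupI:
  assumes "\<gamma> \<in> loop_group"
  shows "loop_reflect \<gamma> \<in> loop_group"
proof -
  have "(\<lambda>j. norm (loop_reflect \<gamma> j)) summable_on UNIV"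
    using loop_group_summable[OF assms] has_sum_uminus_int[of "\<lambda>j. norm (\<gamma> j)"]
    unfolding loop_reflect_def summable_on_def by blast
  moreover have "det (loop_eval (loop_reflect \<gamma>) z) = 1 \<and>
      sigma (loop_eval (loop_reflect \<gamma>) z) = loop_eval (loop_reflect \<gamma>) (- z)"
    if "z \<in> unit_circle" for z
    using that assms inverse_unit_circle[of z]
    unfolding loop_eval_reflect inverse_minus_eq loop_group_def by blast
  ultimately show ?thesis
    by (simp add: loop_group_def)
qed

lemma loop_reflect_group: "loop_reflect \<gamma> \<in> loop_group \<longleftrightarrow> \<gamma> \<in> loop_group"
  using loop_reflect_groupI[of \<gamma>] loop_reflect_groupI[of "loop_reflect \<gamma>"] by auto

lemma loop_reflect_group_anI:
  assumes "\<gamma> \<in> loop_group_an"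
  shows "loop_reflect \<gamma> \<in> loop_group_an"
proof -
  obtain g where hol: "\<And>i k. (\<lambda>z. g z $ i $ k) holomorphic_on (- {0 :: complex})"
    and g: "\<And>z. z \<in> unit_circle \<Longrightarrow> g z = loop_eval \<gamma> z"
    using assms unfolding loop_group_an_def by blast
  have "((\<lambda>z. g z $ i $ k) \<circ> inverse) holomorphic_on (- {0})" for i k
    by (rule holomorphic_on_compose_gen[OF _ hol]) (auto intro!: holomorphic_intros)
  then show ?thesis
    using assms g inverse_unit_circle unfolding loop_group_an_def
    by (auto simp: loop_reflect_group loop_eval_reflect o_def intro!: exI[of _ "\<lambda>z. g (inverse z)"])
qed

lemma loop_reflect_group_an: "loop_reflect \<gamma> \<in> loop_group_an \<longleftrightarrow> \<gamma> \<in> loop_group_an"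
  using loop_reflect_group_anI[of \<gamma>] loop_reflect_group_anI[of "loop_reflect \<gamma>"] by auto

lemma loop_reflect_plus: "loop_reflect \<gamma> \<in> loop_plus \<longleftrightarrow> \<gamma> \<in> loop_minus"
proof -
  have "(\<forall>j<0. \<gamma> (- j) = 0) \<longleftrightarrow> (\<forall>j>0. \<gamma> j = 0)"
    by (metis minus_minus neg_0_less_iff_less neg_less_0_iff_less)
  then show ?thesis
    unfolding loop_plus_def loop_minus_def
    by (simp add: loop_reflect_group_an) (simp add: loop_reflect_def)
qed

lemma loop_reflect_minus: "loop_reflect \<gamma> \<in> loop_minus \<longleftrightarrow> \<gamma> \<in> loop_plus"
  using loop_reflect_plus[of "loop_reflect \<gamma>"] by simp

lemma loop_reflect_plus_star: "loop_reflect \<gamma> \<in> loop_plus_star \<longleftrightarrow> \<gamma> \<in> loop_minus_star"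
  unfolding loop_plus_star_def loop_minus_star_def
  by (simp add: loop_reflect_plus) (simp add: loop_reflect_def)

text \<open>Inverting the parameter respects products and keeps the order of the factors while
  exchanging their types.\<close>

lemma birkhoff_mp_reflect:
  "birkhoff_mp \<gamma> P \<longleftrightarrow> birkhoff_pm (loop_reflect \<gamma>) (map_prod loop_reflect loop_reflect P)"
proof -
  have "loop_mult_eq (loop_reflect \<gamma>) (loop_reflect \<alpha>) (loop_reflect \<beta>) \<longleftrightarrow> loop_mult_eq \<gamma> \<alpha> \<beta>" for \<alpha> \<beta>
    unfolding loop_mult_eq_def loop_eval_reflect
    by (metis inverse_inverse_eq inverse_unit_circle)
  then show ?thesis
    by (cases P) (simp add: birkhoff_mp_def birkhoff_pm_def loop_reflect_plus_star loop_reflect_minus)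
qed

section \<open>Uniqueness and membership criteria for the factors\<close>

text \<open>Two decompositions give \<open>E\<close>, the quotient of the plus factors, which is
  also a quotient of the minus factors. It has only nonnegative and only nonpositive powers, hence
  is constant, and the normalization of the plus factors makes this constant the identity.\<close>

lemma birkhoff_pm_unique:
  assumes P: "birkhoff_pm \<gamma> (p, m)" and P': "birkhoff_pm \<gamma> (p', m')"
  shows "p = p'" and "m = m'"
proof -
  have mem: "p \<in> loop_plus" "p' \<in> loop_plus" "m \<in> loop_minus" "m' \<in> loop_minus"
    and one: "p 0 = mat 1" "p' 0 = mat 1"
    and eq: "\<And>z. z \<in> unit_circle \<Longrightarrow>
      loop_eval p z ** loop_eval m z = loop_eval p' z ** loop_eval m' z"
    using P P' by (auto simp: birkhoff_pm_def loop_plus_star_def loop_mult_eq_def)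
  note det = mem(1,2)[THEN loop_plus_subset, THEN loop_group_det]
    mem(3,4)[THEN loop_minus_subset, THEN loop_group_det]
  define E where "E z = adj2 (loop_eval p' z) ** loop_eval p z" for z
  have E_minus: "E z = loop_eval m' z ** adj2 (loop_eval m z)" if z: "z \<in> unit_circle" for z
  proof -
    have "E z = E z ** (loop_eval m z ** adj2 (loop_eval m z))"
      using adj2_inverse(1)[OF det(3)[OF z]] by simp
    also have "\<dots> = adj2 (loop_eval p' z) ** (loop_eval p' z ** loop_eval m' z) ** adj2 (loop_eval m z)"
      by (simp add: E_def matrix_mul_assoc flip: eq[OF z])
    also have "\<dots> = adj2 (loop_eval p' z) ** loop_eval p' z ** (loop_eval m' z ** adj2 (loop_eval m z))"
      by (simp add: matrix_mul_assoc)
    finally show ?thesis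
      using adj2_inverse(2)[OF det(2)[OF z]] by simp
  qed
  have ps: "power_series_on_circle (\<lambda>z. loop_eval p z $ i $ k) (mat 1 $ i $ k)"
    "power_series_on_circle (\<lambda>z. loop_eval p' z $ i $ k) (mat 1 $ i $ k)" for i k
    using loop_plus_power_series[OF mem(1), of i k] loop_plus_power_series[OF mem(2), of i k]
    by (simp_all add: one mat_nth split: if_splits)
  \<comment> \<open>Reflection turns the minus factors into power series too, in the inverse
    parameter.\<close>
  note ms = mem(3,4)[folded loop_reflect_plus, THEN loop_plus_power_series]
  note ops = power_series_on_circle_diff power_series_on_circle_mult
  \<comment> \<open>In either description an entry of \<open>E\<close> is a difference of two
    products of entries. The indices are left free so that one argument serves all four
    entries.\<close>
  have entry: "f z = mat 1 $ a $ b * mat 1 $ c $ d - mat 1 $ e $ h * mat 1 $ k $ l"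
    if "\<And>z. z \<in> unit_circle \<Longrightarrow> f z = loop_eval p' z $ a $ b * loop_eval p z $ c $ d
          - loop_eval p' z $ e $ h * loop_eval p z $ k $ l"
      and "\<And>z. z \<in> unit_circle \<Longrightarrow> f z = loop_eval m' z $ a' $ b' * loop_eval m z $ c' $ d'
          - loop_eval m' z $ e' $ h' * loop_eval m z $ k' $ l'"
      and "z \<in> unit_circle"
    for f :: "complex \<Rightarrow> complex" and z a b c d e h k l a' b' c' d' e' h' k' l'
  proof -
    have A: "power_series_on_circle (\<lambda>z. loop_eval p' z $ a $ b * loop_eval p z $ c $ d
          - loop_eval p' z $ e $ h * loop_eval p z $ k $ l)
          (mat 1 $ a $ b * mat 1 $ c $ d - mat 1 $ e $ h * mat 1 $ k $ l)"
      by (intro ops ps)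
    have B: "power_series_on_circle
         (\<lambda>z. loop_eval (loop_reflect m') z $ a' $ b' * loop_eval (loop_reflect m) z $ c' $ d'
          - loop_eval (loop_reflect m') z $ e' $ h' * loop_eval (loop_reflect m) z $ k' $ l')
          (of_real (loop_reflect m' 0 $ a' $ b') * of_real (loop_reflect m 0 $ c' $ d')
          - of_real (loop_reflect m' 0 $ e' $ h') * of_real (loop_reflect m 0 $ k' $ l'))"
      by (intro ops ms)
    have "loop_eval p' z $ a $ b * loop_eval p z $ c $ d - loop_eval p' z $ e $ h * loop_eval p z $ k $ l
        = mat 1 $ a $ b * mat 1 $ c $ d - mat 1 $ e $ h * mat 1 $ k $ l"
      using that by (intro power_series_on_circle_constant[OF A B]) (simp_all add: loop_eval_reflect)
    then show ?thesis
      using that by simp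
  qed
  have E1: "E z = mat 1" if z: "z \<in> unit_circle" for z
  proof -
    \<comment> \<open>The first eight indices spell out the entry as a quotient of plus factors, the
      last eight the same entry as a quotient of minus factors.\<close>
    have "E z $ 1 $ 1 = 1"
      by (rule entry[where f = "\<lambda>z. E z $ 1 $ 1", of 2 2 1 1 1 2 2 1 1 1 2 2 1 2 2 1, OF _ _ z, THEN trans])
        (simp add: E_def matrix2_mult_nth, simp add: E_minus matrix2_mult_nth, simp add: mat_nth)
    moreover have "E z $ 1 $ 2 = 0"
      by (rule entry[where f = "\<lambda>z. E z $ 1 $ 2", of 2 2 1 2 1 2 2 2 1 2 1 1 1 1 1 2, OF _ _ z, THEN trans])
        (simp add: E_def matrix2_mult_nth, simp add: E_minus matrix2_mult_nth, simp add: mat_nth)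
    moreover have "E z $ 2 $ 1 = 0"
      by (rule entry[where f = "\<lambda>z. E z $ 2 $ 1", of 1 1 2 1 2 1 1 1 2 1 2 2 2 2 2 1, OF _ _ z, THEN trans])
        (simp add: E_def matrix2_mult_nth, simp add: E_minus matrix2_mult_nth, simp add: mat_nth)
    moreover have "E z $ 2 $ 2 = 1"
      by (rule entry[where f = "\<lambda>z. E z $ 2 $ 2", of 1 1 2 2 2 1 1 2 2 2 1 1 2 1 1 2, OF _ _ z, THEN trans])
        (simp add: E_def matrix2_mult_nth, simp add: E_minus matrix2_mult_nth, simp add: mat_nth)
    ultimately show ?thesis
      by (simp add: matrix2_eq_iff mat_nth)
  qed
  have "loop_eval p z = loop_eval p' z" if z: "z \<in> unit_circle" for z
  proof -
    have "loop_eval p' z = loop_eval p' z ** (adj2 (loop_eval p' z) ** loop_eval p z)"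
      using E1[OF z] by (simp add: E_def)
    then show ?thesis
      using adj2_inverse(1)[OF det(2)[OF z]] by (simp add: matrix_mul_assoc)
  qed
  then show "p = p'"
    by (intro loop_eval_inject loop_group_summable loop_plus_subset mem)
  have "loop_eval m z = loop_eval m' z" if z: "z \<in> unit_circle" for z
  proof -
    have "loop_eval m z = loop_eval m' z ** adj2 (loop_eval m z) ** loop_eval m z"
      using E1[OF z] by (simp add: E_minus[OF z])
    then show ?thesis
      using adj2_inverse(2)[OF det(3)[OF z]] by (simp flip: matrix_mul_assoc)
  qed
  then show "m = m'"
    by (intro loop_eval_inject loop_group_summable loop_minus_subset mem)
qed

text \<open>Summability against every \<open>r\<close> means infinite radius of convergence, which
  provides the analytic extension; the parity pattern is the twisting condition. The determinant is
  hard to read off coefficients and will come from the framing.\<close>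

lemma power_loop_plus:
  assumes s: "\<And>r. summable (\<lambda>n. norm (C n) * r ^ n)"
    and parity: "\<And>n i k. C n $ i $ k \<noteq> 0 \<Longrightarrow> even n \<longleftrightarrow> i = k"
    and det: "\<And>z. z \<in> unit_circle \<Longrightarrow> det (loop_eval (power_loop C) z) = 1"
  shows "power_loop C \<in> loop_plus"
proof -
  have s1: "summable (\<lambda>n. norm (C n))"
    using s[of 1] by simp
  define g where "g z = (\<chi> i k. \<Sum>n. complex_of_real (C n $ i $ k) * z ^ n)" for z
  have g: "g z = loop_eval (power_loop C) z" if "z \<in> unit_circle" for z
    unfolding g_def using that by (simp add: vec_eq_iff loop_eval_power_loop[OF s1])
  have sm: "summable (\<lambda>n. complex_of_real (C n $ i $ k) * z ^ n)" for i k z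
  proof (rule summable_comparison_test'[OF s[of "norm z"], of 0])
    show "norm (complex_of_real (C n $ i $ k) * z ^ n) \<le> norm (C n) * norm z ^ n" for n
      using norm_entry_le[of "C n" i k] by (simp add: norm_mult norm_power mult_right_mono)
  qed
  have hol: "(\<lambda>z. g z $ i $ k) holomorphic_on (- {0})" for i k
    unfolding g_def
    using termdiffs_strong_converges_everywhere[OF sm, of i k]
    by (simp add: holomorphic_on_def field_differentiable_def) (meson has_field_derivative_at_within)
  have sg: "sigma (g z) = g (- z)" for z
  proof -
    have "sigma (g z) $ i $ k = g (- z) $ i $ k" for i k
    proof (cases "i = k")
      case True
      have "complex_of_real (C n $ i $ k) * z ^ n = complex_of_real (C n $ i $ k) * (- z) ^ n" for n
        using parity[of n i k] True by (cases "even n") auto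
      then have "(\<Sum>n. complex_of_real (C n $ i $ k) * z ^ n) = (\<Sum>n. complex_of_real (C n $ i $ k) * (- z) ^ n)"
        by (rule suminf_cong)
      then show ?thesis
        using True by (simp add: sigma_nth g_def)
    next
      case False
      have "- (complex_of_real (C n $ i $ k) * z ^ n) = complex_of_real (C n $ i $ k) * (- z) ^ n" for n
        using parity[of n i k] False by (cases "even n") auto
      then have "(\<Sum>n. - (complex_of_real (C n $ i $ k) * z ^ n)) = (\<Sum>n. complex_of_real (C n $ i $ k) * (- z) ^ n)"
        by (rule suminf_cong)
      then show ?thesis
        using False suminf_minus[OF sm[of i k z]] by (simp add: sigma_nth g_def)
    qed
    then show ?thesis by (simp add: vec_eq_iff)
  qed
  have sig: "sigma (loop_eval (power_loop C) z) = loop_eval (power_loop C) (- z)"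
    if z: "z \<in> unit_circle" for z
  proof -
    have "- z \<in> unit_circle"
      using z by simp
    from g[OF this] g[OF z] sg[of z] show ?thesis
      by metis
  qed
  have "(\<lambda>j. norm (power_loop C j)) summable_on UNIV"
    unfolding power_loop_def by (rule summable_power_int[OF s1])
  then have "power_loop C \<in> loop_group"
    unfolding loop_group_def mem_Collect_eq by (intro conjI ballI det sig)
  moreover have "\<exists>g. (\<forall>i k. (\<lambda>z. g z $ i $ k) holomorphic_on (- {0})) \<and>
      (\<forall>z\<in>unit_circle. g z = loop_eval (power_loop C) z)"
    by (intro exI[of _ g] conjI allI ballI hol g)
  ultimately have "power_loop C \<in> loop_group_an"
    unfolding loop_group_an_def by blast
  then show ?thesis
    unfolding loop_plus_def by (simp add: power_loop_def)
qed

section \<open>Linear systems and iterated integrals\<close>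

text \<open>The Picard estimate: integrating \<open>n\<close> times from zero produces the
  factorial. It serves both the iterated integrals and the remainders of the series built from
  them.\<close>

lemma iterated_derivative_bound:
  fixes r r' :: "nat \<Rightarrow> real \<Rightarrow> 'a::real_normed_vector"
  assumes deriv: "\<And>n t. \<bar>t\<bar> \<le> \<rho> \<Longrightarrow> (r (Suc n) has_vector_derivative r' n t) (at t within {-\<rho>..\<rho>})"
    and bound: "\<And>n t. \<bar>t\<bar> \<le> \<rho> \<Longrightarrow> norm (r' n t) \<le> K * norm (r n t)"
    and zero: "\<And>n. r (Suc n) 0 = 0"
    and r0: "\<And>t. \<bar>t\<bar> \<le> \<rho> \<Longrightarrow> norm (r 0 t) \<le> M"
    and K: "0 \<le> K" and t: "\<bar>t\<bar> \<le> \<rho>"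
  shows "norm (r n t) \<le> M * (K * \<bar>t\<bar>) ^ n / fact n"
  using t
proof (induction n arbitrary: t)
  case 0
  then show ?case using r0 by simp
next
  case (Suc n)
  show ?case
  proof (cases "t = 0")
    case True
    then show ?thesis using zero by simp
  next
    case False
    \<comment> \<open>As \<open>s\<close> increases from 0 to \<open>\<bar>t\<bar>\<close>, the
      point \<open>c * s\<close> runs from 0 to \<open>t\<close>; this covers negative
      \<open>t\<close> with a mean value inequality on a positive interval.\<close>
    define c where "c = sgn t"
    have c: "\<bar>c\<bar> = 1" "c * \<bar>t\<bar> = t" "c \<noteq> 0"
      using False by (auto simp: c_def sgn_mult_abs abs_sgn_eq sgn_zero_iff)
    have in_range: "\<bar>c * s\<bar> \<le> \<rho>" if "0 \<le> s" "s \<le> \<bar>t\<bar>" for s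
      using that Suc.prems c by (simp add: abs_mult)
    then have in_interval: "c * s \<in> {-\<rho>..\<rho>}" if "0 \<le> s" "s \<le> \<bar>t\<bar>" for s
      using that by (simp add: abs_le_iff minus_le_iff)
    have cont: "continuous_on {-\<rho>..\<rho>} (r (Suc n))"
      unfolding continuous_on_eq_continuous_within
      using deriv has_vector_derivative_continuous by (metis abs_le_iff atLeastAtMost_iff minus_le_iff)
    \<comment> \<open>The comparison function is the claimed bound itself: its derivative is
      \<open>K\<close> times the bound for index \<open>n\<close>.\<close>
    have "norm (r (Suc n) (c * \<bar>t\<bar>) - r (Suc n) (c * 0))
        \<le> M * (K * \<bar>t\<bar>) ^ Suc n / fact (Suc n) - M * (K * 0) ^ Suc n / fact (Suc n)"
    proof (rule differentiable_bound_general[where f' = "\<lambda>s. c *\<^sub>R r' n (c * s)" and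
          \<phi>' = "\<lambda>s. K * (M * (K * s) ^ n / fact n)"])
      show "0 < \<bar>t\<bar>" using False by simp
      show "continuous_on {0..\<bar>t\<bar>} (\<lambda>s. r (Suc n) (c * s))"
        by (rule continuous_on_compose2[OF cont]) (use in_interval in \<open>auto intro!: continuous_intros\<close>)
      show "continuous_on {0..\<bar>t\<bar>} (\<lambda>s. M * (K * s) ^ Suc n / fact (Suc n))"
        by (intro continuous_intros) auto
      fix s :: real assume s: "0 < s" "s < \<bar>t\<bar>"
      have lt: "\<bar>c * s\<bar> < \<rho>"
        using s Suc.prems c by (simp add: abs_mult)
      then have "- \<rho> < c * s" "c * s < \<rho>"
        by (simp_all add: abs_less_iff)
      then have "(r (Suc n) has_vector_derivative r' n (c * s)) (at (c * s))"
        using deriv[of "c * s" n] lt at_within_interior[of "c * s" "{-\<rho>..\<rho>}"] by auto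
      moreover have "((*) c has_vector_derivative c) (at s)"
        unfolding has_real_derivative_iff_has_vector_derivative[symmetric]
        by (auto intro!: derivative_eq_intros)
      ultimately show "((\<lambda>s. r (Suc n) (c * s)) has_vector_derivative c *\<^sub>R r' n (c * s)) (at s)"
        using vector_diff_chain_at[of "\<lambda>s. c * s" c s "r (Suc n)"] by (simp add: o_def)
      have "((\<lambda>s. M * (K * s) ^ Suc n / fact (Suc n)) has_real_derivative
          K * (M * (K * s) ^ n / fact n)) (at s)"
        by (rule derivative_eq_intros refl | simp)+ 
      then show "((\<lambda>s. M * (K * s) ^ Suc n / fact (Suc n)) has_vector_derivative
          K * (M * (K * s) ^ n / fact n)) (at s)"
        by (simp add: has_real_derivative_iff_has_vector_derivative)
      have "norm (r' n (c * s)) \<le> K * norm (r n (c * s))"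
        using bound lt by simp
      also have "\<dots> \<le> K * (M * (K * \<bar>c * s\<bar>) ^ n / fact n)"
        using Suc.IH[of "c * s"] lt K by (intro mult_left_mono) auto
      finally show "norm (c *\<^sub>R r' n (c * s)) \<le> K * (M * (K * s) ^ n / fact n)"
        using c s by (simp add: abs_mult)
    qed
    then show ?thesis
      using c zero by simp
  qed
qed

section \<open>Iterated integrals and their growth\<close>

text \<open>The interval from 0 to \<open>t\<close> is empty for negative \<open>t\<close>;
  integrating from \<open>-\<rho>\<close> and subtracting the value at 0 gives a primitive on both
  sides of 0.\<close>

definition primitive :: "real \<Rightarrow> (real \<Rightarrow> real) \<Rightarrow> real \<Rightarrow> real" where
  "primitive \<rho> f t = integral {-\<rho>..t} f - integral {-\<rho>..0} f"

text \<open>The ordered iterated integrals of Picard iteration, with \<open>h 0\<close> as the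
  innermost integrand.\<close>

primrec iterated_integral :: "real \<Rightarrow> (nat \<Rightarrow> real \<Rightarrow> real) \<Rightarrow> nat \<Rightarrow> real \<Rightarrow> real" where
  "iterated_integral \<rho> h 0 = (\<lambda>t. 1)"
| "iterated_integral \<rho> h (Suc n) = primitive \<rho> (\<lambda>t. iterated_integral \<rho> h n t * h n t)"

lemma primitive_zero: "primitive \<rho> f 0 = 0"
  by (simp add: primitive_def)

lemma primitive_derivative:
  assumes "continuous_on {-\<rho>..\<rho>} f" and "t \<in> {-\<rho>..\<rho>}"
  shows "(primitive \<rho> f has_vector_derivative f t) (at t within {-\<rho>..\<rho>})"
  using has_vector_derivative_diff[OF integral_has_vector_derivative[OF assms] has_vector_derivative_const]
  unfolding primitive_def[abs_def] by simp

lemma has_vector_derivative_imp_continuous_on: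
  "(\<And>t. t \<in> S \<Longrightarrow> (f has_vector_derivative f' t) (at t within S)) \<Longrightarrow> continuous_on S f"
  unfolding continuous_on_eq_continuous_within using has_vector_derivative_continuous by blast

lemma iterated_integral_continuous:
  assumes "\<And>n. continuous_on {-\<rho>..\<rho>} (h n)"
  shows "continuous_on {-\<rho>..\<rho>} (iterated_integral \<rho> h n)"
proof (induction n)
  case (Suc n)
  have "continuous_on {-\<rho>..\<rho>} (\<lambda>t. iterated_integral \<rho> h n t * h n t)"
    by (intro continuous_on_mult Suc assms)
  then show ?case
    using has_vector_derivative_imp_continuous_on[OF primitive_derivative] by simp
qed simp

lemma iterated_integral_derivative:
  assumes "\<And>n. continuous_on {-\<rho>..\<rho>} (h n)" and "t \<in> {-\<rho>..\<rho>}"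
  shows "(iterated_integral \<rho> h (Suc n) has_vector_derivative iterated_integral \<rho> h n t * h n t)
    (at t within {-\<rho>..\<rho>})"
  using assms iterated_integral_continuous[of \<rho> h n]
  by (auto intro!: primitive_derivative continuous_on_mult)

lemma iterated_integral_at_0: "iterated_integral \<rho> h n 0 = (if n = 0 then 1 else 0)"
  by (cases n) (simp_all add: primitive_zero)

lemma iterated_integral_bound:
  assumes h: "\<And>n. continuous_on {-\<rho>..\<rho>} (h n)"
    and K: "\<And>n t. \<bar>t\<bar> \<le> \<rho> \<Longrightarrow> \<bar>h n t\<bar> \<le> K" and t: "\<bar>t\<bar> \<le> \<rho>"
  shows "\<bar>iterated_integral \<rho> h n t\<bar> \<le> (K * \<bar>t\<bar>) ^ n / fact n"
proof -
  have "0 \<le> K"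
    using K[OF t] by (meson abs_ge_zero order_trans)
  then have "norm (iterated_integral \<rho> h n t) \<le> 1 * (K * \<bar>t\<bar>) ^ n / fact n"
  proof (rule iterated_derivative_bound[where r' = "\<lambda>n t. iterated_integral \<rho> h n t * h n t", rotated -2])
    fix n and t :: real assume "\<bar>t\<bar> \<le> \<rho>"
    then show "(iterated_integral \<rho> h (Suc n) has_vector_derivative iterated_integral \<rho> h n t * h n t)
        (at t within {-\<rho>..\<rho>})"
      by (intro iterated_integral_derivative h) auto
    show "norm (iterated_integral \<rho> h n t * h n t) \<le> K * norm (iterated_integral \<rho> h n t)"
      using mult_right_mono[OF K[OF \<open>\<bar>t\<bar> \<le> \<rho>\<close>, of n], of "\<bar>iterated_integral \<rho> h n t\<bar>"]
      by (simp add: abs_mult mult.commute)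
  qed (use t in \<open>simp_all add: primitive_zero\<close>)
  then show ?thesis by simp
qed

lemma continuous_bound:
  assumes "continuous_on {-\<rho>..\<rho>} (f :: real \<Rightarrow> 'a::real_normed_vector)"
  shows "\<exists>K. \<forall>t. \<bar>t\<bar> \<le> \<rho> \<longrightarrow> norm (f t) \<le> K"
proof -
  have "bounded (f ` {-\<rho>..\<rho>})"
    using assms by (intro compact_imp_bounded compact_continuous_image) auto
  then obtain K where "\<forall>x\<in>{-\<rho>..\<rho>}. norm (f x) \<le> K"
    unfolding bounded_iff by blast
  then show ?thesis
    by (auto simp: abs_le_iff intro!: exI[of _ K])
qed

text \<open>An off-diagonal coefficient matrix sends each component to the other, so successive
  integrations use its two entries in turn.\<close>

definition alternating :: "'a \<Rightarrow> 'a \<Rightarrow> nat \<Rightarrow> 'a" where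
  "alternating a b n = (if even n then a else b)"

text \<open>The factorial beats every geometric factor \<open>s ^ n\<close>; this makes the series
  in the loop parameter entire.\<close>

lemma iterated_integral_summable:
  assumes "continuous_on {-\<rho>..\<rho>} \<alpha>" and "continuous_on {-\<rho>..\<rho>} \<beta>" and t: "\<bar>t\<bar> \<le> \<rho>"
  shows "summable (\<lambda>n. \<bar>iterated_integral \<rho> (alternating \<alpha> \<beta>) n t\<bar> * s ^ n)"
proof -
  obtain K1 where K1: "\<forall>t. \<bar>t\<bar> \<le> \<rho> \<longrightarrow> norm (\<alpha> t) \<le> K1"
    using continuous_bound[OF assms(1)] by blast
  obtain K2 where K2: "\<forall>t. \<bar>t\<bar> \<le> \<rho> \<longrightarrow> norm (\<beta> t) \<le> K2"
    using continuous_bound[OF assms(2)] by blast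
  define K where "K = max K1 K2"
  have K: "\<bar>alternating \<alpha> \<beta> n t\<bar> \<le> K" if "\<bar>t\<bar> \<le> \<rho>" for n t
    using K1 K2 that by (auto simp: K_def alternating_def)
  have "summable (\<lambda>n. (K * \<bar>t\<bar> * \<bar>s\<bar>) ^ n / fact n)"
    using summable_exp[of "K * \<bar>t\<bar> * \<bar>s\<bar>"] by (simp only: divide_inverse mult.commute)
  moreover have "norm (\<bar>iterated_integral \<rho> (alternating \<alpha> \<beta>) n t\<bar> * s ^ n) \<le> (K * \<bar>t\<bar> * \<bar>s\<bar>) ^ n / fact n" for n
  proof -
    have "\<bar>iterated_integral \<rho> (alternating \<alpha> \<beta>) n t\<bar> * \<bar>s\<bar> ^ n \<le> (K * \<bar>t\<bar>) ^ n / fact n * \<bar>s\<bar> ^ n"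
      using assms K by (intro mult_right_mono iterated_integral_bound) (auto simp: alternating_def)
    then show ?thesis
      by (simp add: abs_mult power_abs power_mult_distrib)
  qed
  ultimately show ?thesis
    by (rule summable_comparison_test'[where N = 0])
qed

text \<open>The remainders of the two series solve the system with the index shifted by one, so they are
  iterated integrals themselves and decay like \<open>K\<^sup>N / N!\<close>.\<close>

lemma off_diagonal_system_series:
  fixes u v :: "real \<Rightarrow> complex"
  assumes \<alpha>: "continuous_on {-\<rho>..\<rho>} \<alpha>" and \<beta>: "continuous_on {-\<rho>..\<rho>} \<beta>"
    and u: "\<And>t. \<bar>t\<bar> \<le> \<rho> \<Longrightarrow> (u has_vector_derivative \<zeta> * of_real (\<beta> t) * v t) (at t within {-\<rho>..\<rho>})"
    and v: "\<And>t. \<bar>t\<bar> \<le> \<rho> \<Longrightarrow> (v has_vector_derivative \<zeta> * of_real (\<alpha> t) * u t) (at t within {-\<rho>..\<rho>})"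
    and init: "u 0 = 1" "v 0 = 0" and \<zeta>: "norm \<zeta> = 1" and t: "\<bar>t\<bar> \<le> \<rho>"
  defines "c \<equiv> iterated_integral \<rho> (alternating \<alpha> \<beta>)"
  shows "(\<lambda>n. of_real (if even n then c n t else 0) * \<zeta> ^ n) sums u t"
    and "(\<lambda>n. of_real (if even n then 0 else c n t) * \<zeta> ^ n) sums v t"
proof -
  \<comment> \<open>Even powers of \<zeta> belong to \<open>u\<close> and odd ones to
    \<open>v\<close>, because each factor \<zeta> passes from one component to the other.\<close>
  define ru where "ru N t = u t - (\<Sum>n<N. of_real (if even n then c n t else 0) * \<zeta> ^ n)" for N t
  define rv where "rv N t = v t - (\<Sum>n<N. of_real (if even n then 0 else c n t) * \<zeta> ^ n)" for N t
  have cont: "continuous_on {-\<rho>..\<rho>} (alternating \<alpha> \<beta> n)" for n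
    using \<alpha> \<beta> by (simp add: alternating_def)
  have c_deriv: "((\<lambda>t. complex_of_real (c (Suc n) t)) has_vector_derivative
      of_real (c n t * (if even n then \<alpha> t else \<beta> t))) (at t within {-\<rho>..\<rho>})" if "\<bar>t\<bar> \<le> \<rho>" for n t
  proof -
    have "t \<in> {-\<rho>..\<rho>}"
      using that by auto
    from iterated_integral_derivative[of \<rho> "alternating \<alpha> \<beta>", OF cont this, of n] show ?thesis
      unfolding c_def alternating_def if_distribR
      by (rule bounded_linear.has_vector_derivative[OF bounded_linear_of_real])
  qed
  have ru': "(ru (Suc N) has_vector_derivative \<zeta> * of_real (\<beta> t) * rv N t) (at t within {-\<rho>..\<rho>})"
    if "\<bar>t\<bar> \<le> \<rho>" for N t
  proof -
    \<comment> \<open>The term of index zero is the constant 1 and vanishes under differentiation;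
      each later term loses one integration and one factor \<zeta>, landing in the series of
      \<open>v\<close>.\<close>
    have eq: "ru (Suc N) = (\<lambda>t. u t - 1 - (\<Sum>n<N. of_real (if even n then 0 else c (Suc n) t) * \<zeta> ^ Suc n))"
      unfolding ru_def fun_eq_iff sum.lessThan_Suc_shift by (auto simp: c_def intro!: sum.cong)
    have "((\<lambda>t. of_real (if even n then 0 else c (Suc n) t) * \<zeta> ^ Suc n) has_vector_derivative
        \<zeta> * of_real (\<beta> t) * (of_real (if even n then 0 else c n t) * \<zeta> ^ n)) (at t within {-\<rho>..\<rho>})" for n
      using has_vector_derivative_mult_left[OF c_deriv[OF that, of n], of "\<zeta> ^ Suc n"]
      by (auto simp: mult_ac)
    then have "(ru (Suc N) has_vector_derivative \<zeta> * of_real (\<beta> t) * v t - 0 -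
        (\<Sum>n<N. \<zeta> * of_real (\<beta> t) * (of_real (if even n then 0 else c n t) * \<zeta> ^ n))) (at t within {-\<rho>..\<rho>})"
      unfolding eq
      by (intro has_vector_derivative_diff has_vector_derivative_sum u that has_vector_derivative_const)
    then show ?thesis
      by (simp add: rv_def sum_distrib_left right_diff_distrib)
  qed
  have rv': "(rv (Suc N) has_vector_derivative \<zeta> * of_real (\<alpha> t) * ru N t) (at t within {-\<rho>..\<rho>})"
    if "\<bar>t\<bar> \<le> \<rho>" for N t
  proof -
    have eq: "rv (Suc N) = (\<lambda>t. v t - (\<Sum>n<N. of_real (if even n then c (Suc n) t else 0) * \<zeta> ^ Suc n))"
      unfolding rv_def fun_eq_iff sum.lessThan_Suc_shift by (auto simp: c_def intro!: sum.cong)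
    have "((\<lambda>t. of_real (if even n then c (Suc n) t else 0) * \<zeta> ^ Suc n) has_vector_derivative
        \<zeta> * of_real (\<alpha> t) * (of_real (if even n then c n t else 0) * \<zeta> ^ n)) (at t within {-\<rho>..\<rho>})" for n
      using has_vector_derivative_mult_left[OF c_deriv[OF that, of n], of "\<zeta> ^ Suc n"]
      by (auto simp: mult_ac)
    then have "(rv (Suc N) has_vector_derivative \<zeta> * of_real (\<alpha> t) * u t -
        (\<Sum>n<N. \<zeta> * of_real (\<alpha> t) * (of_real (if even n then c n t else 0) * \<zeta> ^ n))) (at t within {-\<rho>..\<rho>})"
      unfolding eq
      by (intro has_vector_derivative_diff has_vector_derivative_sum v that)
    then show ?thesis
      by (simp add: ru_def sum_distrib_left right_diff_distrib)
  qed
  obtain K1 where K1: "\<forall>t. \<bar>t\<bar> \<le> \<rho> \<longrightarrow> norm (\<alpha> t) \<le> K1"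
    using continuous_bound[OF \<alpha>] by blast
  obtain K2 where K2: "\<forall>t. \<bar>t\<bar> \<le> \<rho> \<longrightarrow> norm (\<beta> t) \<le> K2"
    using continuous_bound[OF \<beta>] by blast
  define K where "K = max K1 K2"
  have K: "\<bar>\<alpha> t\<bar> \<le> K" "\<bar>\<beta> t\<bar> \<le> K" if "\<bar>t\<bar> \<le> \<rho>" for t
    using K1 K2 that by (auto simp: K_def)
  have K0: "0 \<le> K"
    using K[OF t] by (meson abs_ge_zero order_trans)
  have "continuous_on {-\<rho>..\<rho>} (\<lambda>t. (u t, v t))"
    by (intro continuous_on_Pair has_vector_derivative_imp_continuous_on[OF u]
        has_vector_derivative_imp_continuous_on[OF v]) auto
  then obtain M where M: "\<forall>t. \<bar>t\<bar> \<le> \<rho> \<longrightarrow> norm (u t, v t) \<le> M"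
    using continuous_bound[of \<rho> "\<lambda>t. (u t, v t)"] by blast
  \<comment> \<open>The coupled remainders are treated as one vector-valued sequence;
    \<open>K\<close> bounds both coefficient functions and \<open>M\<close> the solution itself,
    which is the remainder of index zero.\<close>
  have est: "norm (ru N t, rv N t) \<le> M * (K * \<bar>t\<bar>) ^ N / fact N" for N
  proof (rule iterated_derivative_bound[where r = "\<lambda>N t. (ru N t, rv N t)" and
        r' = "\<lambda>N t. (\<zeta> * of_real (\<beta> t) * rv N t, \<zeta> * of_real (\<alpha> t) * ru N t)", OF _ _ _ _ K0 t])
    fix N and t :: real assume t: "\<bar>t\<bar> \<le> \<rho>"
    show "((\<lambda>t. (ru (Suc N) t, rv (Suc N) t)) has_vector_derivative
        (\<zeta> * of_real (\<beta> t) * rv N t, \<zeta> * of_real (\<alpha> t) * ru N t)) (at t within {-\<rho>..\<rho>})"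
      by (intro has_vector_derivative_Pair ru' rv' t)
    have "norm (\<zeta> * of_real (\<beta> t) * rv N t) \<le> K * norm (rv N t)"
      "norm (\<zeta> * of_real (\<alpha> t) * ru N t) \<le> K * norm (ru N t)"
      using K[OF t] \<zeta> by (simp_all add: norm_mult mult_right_mono)
    then have "(norm (\<zeta> * of_real (\<beta> t) * rv N t))\<^sup>2 + (norm (\<zeta> * of_real (\<alpha> t) * ru N t))\<^sup>2
        \<le> (K * norm (rv N t))\<^sup>2 + (K * norm (ru N t))\<^sup>2"
      by (intro add_mono power_mono) auto
    also have "\<dots> = (K * norm (ru N t, rv N t))\<^sup>2"
      by (simp add: norm_Pair power_mult_distrib algebra_simps)
    finally show "norm (\<zeta> * of_real (\<beta> t) * rv N t, \<zeta> * of_real (\<alpha> t) * ru N t) \<le> K * norm (ru N t, rv N t)"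
      using K0 unfolding norm_Pair[of "\<zeta> * of_real (\<beta> t) * rv N t"] by (intro real_le_lsqrt) auto
  next
    fix N show "(ru (Suc N) 0, rv (Suc N) 0) = 0"
      unfolding ru_def rv_def sum.lessThan_Suc_shift
      by (simp add: c_def iterated_integral_at_0 init primitive_zero zero_prod_def sum.neutral)
  next
    fix t :: real assume "\<bar>t\<bar> \<le> \<rho>"
    then show "norm (ru 0 t, rv 0 t) \<le> M"
      using M by (simp add: ru_def rv_def)
  qed
  have "(\<lambda>N. (K * \<bar>t\<bar>) ^ N / fact N) \<longlonglongrightarrow> 0"
    using summable_LIMSEQ_zero[OF summable_exp[of "K * \<bar>t\<bar>"]] by (simp only: divide_inverse mult.commute)
  then have "(\<lambda>N. M * ((K * \<bar>t\<bar>) ^ N / fact N)) \<longlonglongrightarrow> 0"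
    by (rule tendsto_mult_right_zero)
  moreover have "\<forall>\<^sub>F N in sequentially. norm (ru N t, rv N t) \<le> M * ((K * \<bar>t\<bar>) ^ N / fact N)"
    using est by (intro always_eventually allI) (simp only: times_divide_eq_right)
  ultimately have lim: "(\<lambda>N. (ru N t, rv N t)) \<longlonglongrightarrow> 0"
    by (rule Lim_null_comparison[rotated])
  have "(\<lambda>N. u t - ru N t) \<longlonglongrightarrow> u t - fst (0 :: complex \<times> complex)"
    using tendsto_diff[OF tendsto_const tendsto_fst[OF lim], of "u t"] by (simp only: fst_conv)
  moreover have "(\<lambda>N. v t - rv N t) \<longlonglongrightarrow> v t - snd (0 :: complex \<times> complex)"
    using tendsto_diff[OF tendsto_const tendsto_snd[OF lim], of "v t"] by (simp only: snd_conv)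
  ultimately show "(\<lambda>n. of_real (if even n then c n t else 0) * \<zeta> ^ n) sums u t"
    "(\<lambda>n. of_real (if even n then 0 else c n t) * \<zeta> ^ n) sums v t"
    by (simp_all add: sums_def ru_def rv_def)
qed

section \<open>Matrix form of the series solution\<close>

definition mat2 :: "'a::zero \<Rightarrow> 'a \<Rightarrow> 'a \<Rightarrow> 'a \<Rightarrow> 'a^2^2" where
  "mat2 a b c d = vector [vector [a, b], vector [c, d]]"

lemma mat2_nth [simp]:
  "mat2 a b c d $ 1 $ 1 = a" "mat2 a b c d $ 1 $ 2 = b"
  "mat2 a b c d $ 2 $ 1 = c" "mat2 a b c d $ 2 $ 2 = d"
  by (simp_all add: mat2_def)

lemma has_vector_derivative_entry:
  "(X has_vector_derivative X') F \<Longrightarrow> ((\<lambda>t. X t $ i $ k) has_vector_derivative X' $ i $ k) F"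
  by (intro bounded_linear.has_vector_derivative[OF bounded_linear_vec_nth])

lemma has_derivative_vecI:
  fixes f :: "'a::real_normed_vector \<Rightarrow> 'b::euclidean_space^'n"
  assumes "\<And>i. ((\<lambda>x. f x $ i) has_derivative (\<lambda>v. f' v $ i)) (at a within S)"
  shows "(f has_derivative f') (at a within S)"
proof (subst has_derivative_componentwise_within, intro ballI)
  fix b :: "'b^'n" assume "b \<in> Basis"
  then obtain i u where "b = axis i u" "u \<in> Basis"
    unfolding Basis_vec_def by blast
  then show "((\<lambda>x. f x \<bullet> b) has_derivative (\<lambda>v. f' v \<bullet> b)) (at a within S)"
    using has_derivative_inner_left[OF assms[of i], of u] by (simp add: inner_axis)
qed

lemma has_vector_derivative_entryI:
  fixes X :: "real \<Rightarrow> complex^2^2"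
  assumes "\<And>i k. ((\<lambda>t. X t $ i $ k) has_vector_derivative X' $ i $ k) (at a within S)"
  shows "(X has_vector_derivative X') (at a within S)"
  using assms unfolding has_vector_derivative_def
  by (intro has_derivative_vecI) simp

lemma forall_entry2: "(\<forall>i k. P i k) \<longleftrightarrow> P 1 1 \<and> P 1 2 \<and> P 2 1 \<and> P (2::2) (2::2)"
  by (auto simp: forall_2)

text \<open>Coefficients of the path-ordered exponential of an off-diagonal matrix. Even orders are
  diagonal and odd ones off-diagonal, which is the twisting condition.\<close>

definition series_coeff :: "real \<Rightarrow> (real \<Rightarrow> real) \<Rightarrow> (real \<Rightarrow> real) \<Rightarrow> real \<Rightarrow> nat \<Rightarrow> real^2^2" where
  "series_coeff \<rho> \<alpha> \<beta> t n =
    (let c = iterated_integral \<rho> (alternating \<alpha> \<beta>) n t;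
         d = iterated_integral \<rho> (alternating \<beta> \<alpha>) n t
     in if even n then mat2 c 0 0 d else mat2 0 c d 0)"

lemma series_coeff_nth:
  "series_coeff \<rho> \<alpha> \<beta> t n $ 1 $ 1 = (if even n then iterated_integral \<rho> (alternating \<alpha> \<beta>) n t else 0)"
  "series_coeff \<rho> \<alpha> \<beta> t n $ 1 $ 2 = (if even n then 0 else iterated_integral \<rho> (alternating \<alpha> \<beta>) n t)"
  "series_coeff \<rho> \<alpha> \<beta> t n $ 2 $ 1 = (if even n then 0 else iterated_integral \<rho> (alternating \<beta> \<alpha>) n t)"
  "series_coeff \<rho> \<alpha> \<beta> t n $ 2 $ 2 = (if even n then iterated_integral \<rho> (alternating \<beta> \<alpha>) n t else 0)"
  by (simp_all add: series_coeff_def Let_def)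

lemma series_coeff_parity: "series_coeff \<rho> \<alpha> \<beta> t n $ i $ k \<noteq> 0 \<Longrightarrow> even n \<longleftrightarrow> i = k"
proof -
  have "\<forall>i k. series_coeff \<rho> \<alpha> \<beta> t n $ i $ k \<noteq> 0 \<longrightarrow> (even n \<longleftrightarrow> i = k)"
    unfolding forall_entry2 by (simp add: series_coeff_def Let_def)
  then show "series_coeff \<rho> \<alpha> \<beta> t n $ i $ k \<noteq> 0 \<Longrightarrow> even n \<longleftrightarrow> i = k"
    by blast
qed

lemma norm_matrix2_le:
  fixes A :: "real^2^2"
  shows "norm A \<le> \<bar>A$1$1\<bar> + \<bar>A$1$2\<bar> + \<bar>A$2$1\<bar> + \<bar>A$2$2\<bar>"
proof -
  have "norm A \<le> norm (A$1) + norm (A$2)"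
    unfolding norm_vec_def[of A] using L2_set_le_sum[of UNIV "\<lambda>i. norm (A$i)"] by (simp add: sum_2)
  moreover have "norm (A$i) \<le> \<bar>A$i$1\<bar> + \<bar>A$i$2\<bar>" for i
    using norm_le_l1_cart[of "A$i"] by (simp add: sum_2)
  ultimately show ?thesis
    by (smt (verit))
qed

lemma series_coeff_summable:
  assumes "continuous_on {-\<rho>..\<rho>} \<alpha>" and "continuous_on {-\<rho>..\<rho>} \<beta>" and "\<bar>t\<bar> \<le> \<rho>"
  shows "summable (\<lambda>n. norm (series_coeff \<rho> \<alpha> \<beta> t n) * s ^ n)"
proof (rule summable_comparison_test'[where N = 0])
  show "summable (\<lambda>n. \<bar>iterated_integral \<rho> (alternating \<alpha> \<beta>) n t\<bar> * \<bar>s\<bar> ^ n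
      + \<bar>iterated_integral \<rho> (alternating \<beta> \<alpha>) n t\<bar> * \<bar>s\<bar> ^ n)"
    by (intro summable_add iterated_integral_summable assms)
  fix n
  have "norm (series_coeff \<rho> \<alpha> \<beta> t n) \<le> \<bar>iterated_integral \<rho> (alternating \<alpha> \<beta>) n t\<bar>
      + \<bar>iterated_integral \<rho> (alternating \<beta> \<alpha>) n t\<bar>"
    by (rule order_trans[OF norm_matrix2_le]) (simp add: series_coeff_def Let_def)
  then have "norm (series_coeff \<rho> \<alpha> \<beta> t n) * \<bar>s\<bar> ^ n \<le> (\<bar>iterated_integral \<rho> (alternating \<alpha> \<beta>) n t\<bar>
      + \<bar>iterated_integral \<rho> (alternating \<beta> \<alpha>) n t\<bar>) * \<bar>s\<bar> ^ n"
    by (rule mult_right_mono) simp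
  then show "norm (norm (series_coeff \<rho> \<alpha> \<beta> t n) * s ^ n)
      \<le> \<bar>iterated_integral \<rho> (alternating \<alpha> \<beta>) n t\<bar> * \<bar>s\<bar> ^ n
      + \<bar>iterated_integral \<rho> (alternating \<beta> \<alpha>) n t\<bar> * \<bar>s\<bar> ^ n"
    by (simp add: abs_mult power_abs distrib_right)
qed

lemma matrix_system_series:
  assumes \<alpha>: "continuous_on {-\<rho>..\<rho>} \<alpha>" and \<beta>: "continuous_on {-\<rho>..\<rho>} \<beta>"
    and X: "\<And>t. \<bar>t\<bar> \<le> \<rho> \<Longrightarrow> (X has_vector_derivative
        X t ** mat2 0 (\<zeta> * of_real (\<alpha> t)) (\<zeta> * of_real (\<beta> t)) 0) (at t)"
    and init: "X 0 = mat 1" and \<zeta>: "norm \<zeta> = 1" and t: "\<bar>t\<bar> \<le> \<rho>"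
  shows "(\<lambda>n. complex_of_real (series_coeff \<rho> \<alpha> \<beta> t n $ i $ k) * \<zeta> ^ n) sums X t $ i $ k"
proof -
  have entry: "((\<lambda>t. X t $ i $ k) has_vector_derivative
      (X t ** mat2 0 (\<zeta> * of_real (\<alpha> t)) (\<zeta> * of_real (\<beta> t)) 0) $ i $ k) (at t within S)"
    if "\<bar>t\<bar> \<le> \<rho>" for i k t S
    by (rule has_vector_derivative_at_within, rule has_vector_derivative_entry, rule X[OF that])
  have X': "((\<lambda>t. X t $ i $ 1) has_vector_derivative \<zeta> * of_real (\<beta> t) * X t $ i $ 2) (at t within S)"
    "((\<lambda>t. X t $ i $ 2) has_vector_derivative \<zeta> * of_real (\<alpha> t) * X t $ i $ 1) (at t within S)"
    if "\<bar>t\<bar> \<le> \<rho>" for i t S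
    using entry[OF that, of i 1 S] entry[OF that, of i 2 S] unfolding matrix2_mult_nth
    by (simp_all add: mult.commute)
  have init': "X 0 $ 1 $ 1 = 1" "X 0 $ 1 $ 2 = 0" "X 0 $ 2 $ 2 = 1" "X 0 $ 2 $ 1 = 0"
    by (simp_all add: init mat_nth)
  \<comment> \<open>The coefficient matrix multiplies from the right, so the rows evolve separately.
    The second row starts at (0,1), which exchanges the two components and with them \<alpha> and
    \<beta>.\<close>
  note row1 = off_diagonal_system_series[OF \<alpha> \<beta> X'(1)[of _ 1] X'(2)[of _ 1] init'(1,2) \<zeta> t]
  note row2 = off_diagonal_system_series[OF \<beta> \<alpha> X'(2)[of _ 2] X'(1)[of _ 2] init'(3,4) \<zeta> t]
  have "\<forall>i k. (\<lambda>n. complex_of_real (series_coeff \<rho> \<alpha> \<beta> t n $ i $ k) * \<zeta> ^ n) sums X t $ i $ k"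
    unfolding forall_entry2 series_coeff_nth by (intro conjI row1 row2)
  then show ?thesis by blast
qed

section \<open>Gauging away the diagonal\<close>

text \<open>The logarithmic derivative of the diagonal gauge cancels the diagonal of the connection,
  and conjugation by the gauge rescales the off-diagonal entries by reciprocal exponentials. The
  constant \<open>c\<close> fixes where the gauge is the identity.\<close>

lemma gauge_derivative:
  fixes Z :: "real \<Rightarrow> complex^2^2" and \<theta> :: "real \<Rightarrow> real" and \<theta>' \<alpha> \<beta> c t :: real
  assumes Z: "(Z has_vector_derivative Z t ** mat2 (of_real \<theta>') (\<zeta> * of_real \<alpha>) (\<zeta> * of_real \<beta>) (- of_real \<theta>')) (at t)"
    and \<theta>: "(\<theta> has_real_derivative \<theta>') (at t)"
  defines "Y \<equiv> \<lambda>t. Z t ** mat2 (of_real (exp (c - \<theta> t))) 0 0 (of_real (exp (\<theta> t - c)))"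
  shows "(Y has_vector_derivative Y t ** mat2 0 (\<zeta> * of_real (exp (2 * (\<theta> t - c)) * \<alpha>))
      (\<zeta> * of_real (exp (2 * (c - \<theta> t)) * \<beta>)) 0) (at t)"
proof (rule has_vector_derivative_entryI)
  have e1: "((\<lambda>t. complex_of_real (exp (c - \<theta> t))) has_vector_derivative
      of_real (- \<theta>' * exp (c - \<theta> t))) (at t)"
    by (intro has_vector_derivative_of_real) (auto intro!: derivative_eq_intros \<theta>)
  have e2: "((\<lambda>t. complex_of_real (exp (\<theta> t - c))) has_vector_derivative
      of_real (\<theta>' * exp (\<theta> t - c))) (at t)"
    by (intro has_vector_derivative_of_real) (auto intro!: derivative_eq_intros \<theta>)
  \<comment> \<open>Naming the exponentials reduces the check to polynomial algebra, with
    \<open>p = q * P\<close> and \<open>q = p * Q\<close> as the only relations.\<close>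
  define p q P Q where "p = complex_of_real (exp (c - \<theta> t))" and "q = complex_of_real (exp (\<theta> t - c))"
    and "P = complex_of_real (exp (2 * (c - \<theta> t)))" and "Q = complex_of_real (exp (2 * (\<theta> t - c)))"
  have "exp (c - \<theta> t) = exp (\<theta> t - c) * exp (2 * (c - \<theta> t))"
    "exp (\<theta> t - c) = exp (c - \<theta> t) * exp (2 * (\<theta> t - c))"
    by (simp_all flip: exp_add)
  then have pq: "p = q * P" "q = p * Q"
    unfolding p_def q_def P_def Q_def by (simp_all only: flip: of_real_mult)
  note d1 = e1[unfolded of_real_mult, folded p_def] and d2 = e2[unfolded of_real_mult, folded q_def]
  have Y: "(Y t ** mat2 0 (\<zeta> * of_real (exp (2 * (\<theta> t - c)) * \<alpha>)) (\<zeta> * of_real (exp (2 * (c - \<theta> t)) * \<beta>)) 0)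
      = Z t ** mat2 p 0 0 q ** mat2 0 (\<zeta> * (Q * of_real \<alpha>)) (\<zeta> * (P * of_real \<beta>)) 0"
    unfolding Y_def p_def q_def P_def Q_def of_real_mult ..
  fix i k
  have "\<forall>k. ((\<lambda>t. Y t $ i $ k) has_vector_derivative (Y t ** mat2 0 (\<zeta> * of_real (exp (2 * (\<theta> t - c)) * \<alpha>))
      (\<zeta> * of_real (exp (2 * (c - \<theta> t)) * \<beta>)) 0) $ i $ k) (at t)"
    unfolding Y
    unfolding forall_2
  proof
    have "(Z t ** mat2 p 0 0 q ** mat2 0 (\<zeta> * (Q * of_real \<alpha>)) (\<zeta> * (P * of_real \<beta>)) 0) $ i $ 1
        = Z t $ i $ 1 * (of_real (- \<theta>') * p) + (Z t ** mat2 (of_real \<theta>') (\<zeta> * of_real \<alpha>) (\<zeta> * of_real \<beta>) (- of_real \<theta>')) $ i $ 1 * p"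
      unfolding pq(1) by (simp add: matrix2_mult_nth algebra_simps)
    then show "((\<lambda>t. Y t $ i $ 1) has_vector_derivative (Z t ** mat2 p 0 0 q **
        mat2 0 (\<zeta> * (Q * of_real \<alpha>)) (\<zeta> * (P * of_real \<beta>)) 0) $ i $ 1) (at t)"
      using has_vector_derivative_mult[OF has_vector_derivative_entry[OF Z, of i 1] d1]
      by (simp only: p_def) (simp add: Y_def matrix2_mult_nth)
    have "(Z t ** mat2 p 0 0 q ** mat2 0 (\<zeta> * (Q * of_real \<alpha>)) (\<zeta> * (P * of_real \<beta>)) 0) $ i $ 2
        = Z t $ i $ 2 * (of_real \<theta>' * q) + (Z t ** mat2 (of_real \<theta>') (\<zeta> * of_real \<alpha>) (\<zeta> * of_real \<beta>) (- of_real \<theta>')) $ i $ 2 * q"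
      unfolding pq(2) by (simp add: matrix2_mult_nth algebra_simps)
    then show "((\<lambda>t. Y t $ i $ 2) has_vector_derivative (Z t ** mat2 p 0 0 q **
        mat2 0 (\<zeta> * (Q * of_real \<alpha>)) (\<zeta> * (P * of_real \<beta>)) 0) $ i $ 2) (at t)"
      using has_vector_derivative_mult[OF has_vector_derivative_entry[OF Z, of i 2] d2]
      by (simp only: q_def) (simp add: Y_def matrix2_mult_nth)
  qed
  then show "((\<lambda>t. Y t $ i $ k) has_vector_derivative (Y t ** mat2 0 (\<zeta> * of_real (exp (2 * (\<theta> t - c)) * \<alpha>))
      (\<zeta> * of_real (exp (2 * (c - \<theta> t)) * \<beta>)) 0) $ i $ k) (at t)"
    by blast
qed

section \<open>Birkhoff decomposition of a framing on a box\<close>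

lemma mat2_mult [simp]:
  "mat2 a b c d ** mat2 a' b' c' d' =
    mat2 (a * a' + b * c') (a * b' + b * d') (c * a' + d * c') (c * b' + d * (d' :: 'a::semiring_1))"
  by (simp add: matrix2_eq_iff matrix2_mult_nth)

lemma det_mat2: "det (mat2 a b c d) = a * d - b * (c :: 'a::comm_ring_1)"
  by (simp add: det_2)

lemma mat2_one: "mat2 1 0 0 1 = mat 1"
  by (simp add: matrix2_eq_iff mat_nth)

lemma loop_eval_one: "loop_eval one_loop z = mat 1"
proof -
  have "(\<Sum>\<^sub>\<infinity>j. complex_of_real (one_loop j $ i $ k) * z powi j) = mat 1 $ i $ k" for i k
  proof -
    have "(\<Sum>\<^sub>\<infinity>j. complex_of_real (one_loop j $ i $ k) * z powi j)
        = (\<Sum>\<^sub>\<infinity>j\<in>{0}. complex_of_real (one_loop j $ i $ k) * z powi j)"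
      by (rule infsum_cong_neutral) (auto simp: one_loop_def)
    then show ?thesis
      by (simp add: one_loop_def mat_nth)
  qed
  then show ?thesis
    by (simp add: vec_eq_iff loop_eval_nth)
qed

definition diag_exp :: "real \<Rightarrow> complex^2^2" where
  "diag_exp a = mat2 (of_real (exp a)) 0 0 (of_real (exp (- a)))"

lemma diag_exp_mult: "diag_exp a ** diag_exp b = diag_exp (a + b)"
  by (simp add: diag_exp_def flip: exp_add of_real_mult)

lemma diag_exp_0: "diag_exp 0 = mat 1"
  by (simp add: diag_exp_def mat2_one)

lemma det_diag_exp: "det (diag_exp a) = 1"
  by (simp add: diag_exp_def det_mat2 exp_minus flip: of_real_mult)

text \<open>Left invariance of the equation: a framing can be renormalized to start at the identity
  at any base point.\<close>

lemma matrix_mult_left_derivative: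
  fixes K X :: "complex^2^2"
  assumes "(Z has_vector_derivative Z t ** X) (at t)"
  shows "((\<lambda>t. K ** Z t) has_vector_derivative K ** Z t ** X) (at t)"
proof (rule has_vector_derivative_entryI)
  fix i k
  have "((\<lambda>t. Z t $ j $ k) has_vector_derivative (Z t ** X) $ j $ k) (at t)" for j
    by (rule has_vector_derivative_entry[OF assms])
  then have "((\<lambda>t. K $ i $ 1 * Z t $ 1 $ k + K $ i $ 2 * Z t $ 2 $ k) has_vector_derivative
      K $ i $ 1 * (Z t ** X) $ 1 $ k + K $ i $ 2 * (Z t ** X) $ 2 $ k) (at t)"
    by (intro has_vector_derivative_add has_vector_derivative_mult_right)
  then show "((\<lambda>t. (K ** Z t) $ i $ k) has_vector_derivative (K ** Z t ** X) $ i $ k) (at t)"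
    by (simp add: matrix2_mult_nth flip: matrix_mul_assoc)
qed

text \<open>The diagonal entries are the derivatives of \<open>\<theta>\<close> and \<open>\<eta>\<close>, which makes the gauges explicit. Both
  \<open>F x y = \<Phi> (x, y)\<close> and \<open>F x y = loop_reflect (\<Phi> (y, x))\<close> are instances, the latter for \<open>\<Phi>\<^sub>-\<close>.\<close>

locale box_framing =
  fixes \<rho> :: real and F :: "real \<Rightarrow> real \<Rightarrow> loop"
    and \<theta> \<theta>' \<alpha> \<beta> :: "real \<Rightarrow> real" and \<eta> \<eta>' \<gamma> \<delta> :: "real \<Rightarrow> real \<Rightarrow> real"
  assumes F_0: "F 0 0 = one_loop"
    and F_group: "\<And>x y. \<bar>x\<bar> \<le> \<rho> \<Longrightarrow> \<bar>y\<bar> \<le> \<rho> \<Longrightarrow> F x y \<in> loop_group"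
    and F_x: "\<And>x z. \<bar>x\<bar> \<le> \<rho> \<Longrightarrow> z \<in> unit_circle \<Longrightarrow>
      ((\<lambda>t. loop_eval (F t 0) z) has_vector_derivative loop_eval (F x 0) z **
        mat2 (of_real (\<theta>' x)) (z * of_real (\<alpha> x)) (z * of_real (\<beta> x)) (- of_real (\<theta>' x))) (at x)"
    and F_y: "\<And>x y z. \<bar>x\<bar> \<le> \<rho> \<Longrightarrow> \<bar>y\<bar> \<le> \<rho> \<Longrightarrow> z \<in> unit_circle \<Longrightarrow>
      ((\<lambda>t. loop_eval (F x t) z) has_vector_derivative loop_eval (F x y) z **
        mat2 (of_real (\<eta>' x y)) (inverse z * of_real (\<gamma> x y))
          (inverse z * of_real (\<delta> x y)) (- of_real (\<eta>' x y))) (at y)"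
    and \<theta>: "\<And>x. \<bar>x\<bar> \<le> \<rho> \<Longrightarrow> (\<theta> has_real_derivative \<theta>' x) (at x)"
    and \<eta>: "\<And>x y. \<bar>x\<bar> \<le> \<rho> \<Longrightarrow> \<bar>y\<bar> \<le> \<rho> \<Longrightarrow> (\<eta> x has_real_derivative \<eta>' x y) (at y)"
    and cont: "continuous_on {-\<rho>..\<rho>} \<alpha>" "continuous_on {-\<rho>..\<rho>} \<beta>"
      "\<And>x. \<bar>x\<bar> \<le> \<rho> \<Longrightarrow> continuous_on {-\<rho>..\<rho>} (\<gamma> x)"
      "\<And>x. \<bar>x\<bar> \<le> \<rho> \<Longrightarrow> continuous_on {-\<rho>..\<rho>} (\<delta> x)"
begin

section \<open>Explicit Birkhoff factors\<close>

text \<open>Here and in \<open>pot21\<close>: the off-diagonal entries of the connection along the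
  axis after gauging. Up to the loop parameter they become the entries of the normalized
  potential.\<close>

definition pot12 where "pot12 x = exp (2 * (\<theta> x - \<theta> 0)) * \<alpha> x"
definition pot21 where "pot21 x = exp (2 * (\<theta> 0 - \<theta> x)) * \<beta> x"

text \<open>The candidate plus factor; it involves the first coordinate alone, which is why the
  potential has no second component.\<close>

definition plus_part :: "real \<Rightarrow> loop" where
  "plus_part x = power_loop (series_coeff \<rho> pot12 pot21 x)"

definition dual12 where "dual12 x y = exp (2 * (\<eta> x y - \<eta> x 0)) * \<gamma> x y"
definition dual21 where "dual21 x y = exp (2 * (\<eta> x 0 - \<eta> x y)) * \<delta> x y"

text \<open>The left diagonal matrix undoes the gauge along the axis, absorbed into the plus factor;
  the right one undoes the gauge along the vertical segment.\<close>

definition minus_coeff :: "real \<Rightarrow> real \<Rightarrow> nat \<Rightarrow> real^2^2" where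
  "minus_coeff x y n = mat2 (exp (\<theta> x - \<theta> 0)) 0 0 (exp (\<theta> 0 - \<theta> x)) ** series_coeff \<rho> (dual12 x) (dual21 x) y n
     ** mat2 (exp (\<eta> x y - \<eta> x 0)) 0 0 (exp (\<eta> x 0 - \<eta> x y))"

definition minus_part :: "real \<Rightarrow> real \<Rightarrow> loop" where
  "minus_part x y = loop_reflect (power_loop (minus_coeff x y))"

lemma continuous_\<theta>: "continuous_on {-\<rho>..\<rho>} \<theta>"
  by (rule DERIV_continuous_on[of _ _ \<theta>'], rule has_field_derivative_at_within, rule \<theta>) auto

lemma continuous_\<eta>: "\<bar>x\<bar> \<le> \<rho> \<Longrightarrow> continuous_on {-\<rho>..\<rho>} (\<eta> x)"
  by (rule DERIV_continuous_on[of _ _ "\<eta>' x"], rule has_field_derivative_at_within, rule \<eta>) auto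

lemma continuous_pot: "continuous_on {-\<rho>..\<rho>} pot12" "continuous_on {-\<rho>..\<rho>} pot21"
  unfolding pot12_def[abs_def] pot21_def[abs_def] by (intro continuous_intros continuous_\<theta> cont)+

lemma continuous_dual:
  assumes "\<bar>x\<bar> \<le> \<rho>"
  shows "continuous_on {-\<rho>..\<rho>} (dual12 x)" "continuous_on {-\<rho>..\<rho>} (dual21 x)"
  unfolding dual12_def[abs_def] dual21_def[abs_def] by (intro continuous_intros continuous_\<eta> cont assms)+

lemma gauged_derivative:
  assumes "\<bar>x\<bar> \<le> \<rho>" and "z \<in> unit_circle"
  shows "((\<lambda>t. loop_eval (F t 0) z ** diag_exp (\<theta> 0 - \<theta> t)) has_vector_derivative
    loop_eval (F x 0) z ** diag_exp (\<theta> 0 - \<theta> x) ** mat2 0 (z * of_real (pot12 x)) (z * of_real (pot21 x)) 0) (at x)"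
  using gauge_derivative[OF F_x[OF assms] \<theta>[OF assms(1)], of "\<theta> 0"]
  by (simp add: pot12_def pot21_def diag_exp_def)

text \<open>The gauged framing solves the off-diagonal system with initial value the identity, so it
  is the sum of the series of iterated integrals.\<close>

lemma eval_plus_part:
  assumes x: "\<bar>x\<bar> \<le> \<rho>" and z: "z \<in> unit_circle"
  shows "loop_eval (plus_part x) z = loop_eval (F x 0) z ** diag_exp (\<theta> 0 - \<theta> x)"
proof -
  have "summable (\<lambda>n. norm (series_coeff \<rho> pot12 pot21 x n))"
    using series_coeff_summable[OF continuous_pot x, of 1] by simp
  note eval = loop_eval_power_loop[OF this z]
  have "norm z = 1"
    using z by simp
  have init: "loop_eval (F 0 0) z ** diag_exp (\<theta> 0 - \<theta> 0) = mat 1"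
    by (simp add: F_0 loop_eval_one diag_exp_0)
  have "(\<lambda>n. complex_of_real (series_coeff \<rho> pot12 pot21 x n $ i $ k) * z ^ n) sums
      (loop_eval (F x 0) z ** diag_exp (\<theta> 0 - \<theta> x)) $ i $ k" for i k
    by (rule matrix_system_series[where X = "\<lambda>t. loop_eval (F t 0) z ** diag_exp (\<theta> 0 - \<theta> t)",
          OF continuous_pot gauged_derivative[OF _ z] init \<open>norm z = 1\<close> x])
  then show ?thesis
    by (simp add: vec_eq_iff plus_part_def eval sums_unique[symmetric])
qed

lemma det_F: "\<bar>x\<bar> \<le> \<rho> \<Longrightarrow> \<bar>y\<bar> \<le> \<rho> \<Longrightarrow> z \<in> unit_circle \<Longrightarrow> det (loop_eval (F x y) z) = 1"
  using F_group loop_group_det by blast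

text \<open>The determinant is inherited from the framing and the gauge, both of determinant
  one.\<close>

lemma det_plus_part: "\<bar>x\<bar> \<le> \<rho> \<Longrightarrow> z \<in> unit_circle \<Longrightarrow> det (loop_eval (plus_part x) z) = 1"
  by (simp add: eval_plus_part det_mul det_F det_diag_exp)

lemma plus_part_star:
  assumes x: "\<bar>x\<bar> \<le> \<rho>"
  shows "plus_part x \<in> loop_plus_star"
proof -
  have "plus_part x \<in> loop_plus"
    unfolding plus_part_def
    using series_coeff_summable[OF continuous_pot x] series_coeff_parity det_plus_part[OF x, unfolded plus_part_def]
    by (rule power_loop_plus)
  moreover have "plus_part x 0 = mat 1"
    by (simp add: plus_part_def power_loop_def series_coeff_def mat2_one)
  ultimately show ?thesis
    by (simp add: loop_plus_star_def)
qed

text \<open>The series is identified with the gauged framing only on the closed interval; strict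
  inequality gives a neighbourhood on which the derivative can be transferred.\<close>

lemma plus_part_derivative:
  assumes x: "\<bar>x\<bar> < \<rho>" and z: "z \<in> unit_circle"
  shows "((\<lambda>t. loop_eval (plus_part t) z) has_vector_derivative
    loop_eval (plus_part x) z ** mat2 0 (z * of_real (pot12 x)) (z * of_real (pot21 x)) 0) (at x)"
proof (rule has_vector_derivative_transform_within_open[where S = "{-\<rho><..<\<rho>}"])
  show "((\<lambda>t. loop_eval (F t 0) z ** diag_exp (\<theta> 0 - \<theta> t)) has_vector_derivative
    loop_eval (plus_part x) z ** mat2 0 (z * of_real (pot12 x)) (z * of_real (pot21 x)) 0) (at x)"
    using gauged_derivative[OF _ z, of x] x by (simp add: eval_plus_part[OF _ z])
  show "loop_eval (F t 0) z ** diag_exp (\<theta> 0 - \<theta> t) = loop_eval (plus_part t) z"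
    if "t \<in> {-\<rho><..<\<rho>}" for t
    using that z by (intro eval_plus_part[symmetric]) auto
qed (use x in auto)

lemma minus_coeff_nth:
  "minus_coeff x y n $ i $ k = (if i = 1 then exp (\<theta> x - \<theta> 0) else exp (\<theta> 0 - \<theta> x)) *
    series_coeff \<rho> (dual12 x) (dual21 x) y n $ i $ k * (if k = 1 then exp (\<eta> x y - \<eta> x 0) else exp (\<eta> x 0 - \<eta> x y))"
proof -
  have "\<forall>i k. minus_coeff x y n $ i $ k = (if i = 1 then exp (\<theta> x - \<theta> 0) else exp (\<theta> 0 - \<theta> x)) *
    series_coeff \<rho> (dual12 x) (dual21 x) y n $ i $ k * (if k = 1 then exp (\<eta> x y - \<eta> x 0) else exp (\<eta> x 0 - \<eta> x y))"
    unfolding forall_entry2 by (simp add: minus_coeff_def matrix2_mult_nth)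
  then show ?thesis by blast
qed

lemma minus_coeff_summable:
  assumes x: "\<bar>x\<bar> \<le> \<rho>" and y: "\<bar>y\<bar> \<le> \<rho>"
  shows "summable (\<lambda>n. norm (minus_coeff x y n) * s ^ n)"
proof -
  \<comment> \<open>A product of sums of positive numbers dominates each product of a left and a
    right gauge entry. The factor 4 below counts the matrix entries.\<close>
  define M where "M = (exp (\<theta> x - \<theta> 0) + exp (\<theta> 0 - \<theta> x)) * (exp (\<eta> x y - \<eta> x 0) + exp (\<eta> x 0 - \<eta> x y))"
  have entry: "\<bar>minus_coeff x y n $ i $ k\<bar> \<le> M * norm (series_coeff \<rho> (dual12 x) (dual21 x) y n)" for n i k
  proof -
    have "\<bar>minus_coeff x y n $ i $ k\<bar> = (if i = 1 then exp (\<theta> x - \<theta> 0) else exp (\<theta> 0 - \<theta> x)) *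
        (if k = 1 then exp (\<eta> x y - \<eta> x 0) else exp (\<eta> x 0 - \<eta> x y)) * \<bar>series_coeff \<rho> (dual12 x) (dual21 x) y n $ i $ k\<bar>"
      by (simp add: minus_coeff_nth abs_mult)
    also have "\<dots> \<le> M * norm (series_coeff \<rho> (dual12 x) (dual21 x) y n)"
      unfolding M_def using norm_entry_le[of "series_coeff \<rho> (dual12 x) (dual21 x) y n" i k]
      by (intro mult_mono) (auto simp: less_imp_le)
    finally show ?thesis .
  qed
  have norm_le: "norm (minus_coeff x y n) \<le> 4 * M * norm (series_coeff \<rho> (dual12 x) (dual21 x) y n)" for n
    using norm_matrix2_le[of "minus_coeff x y n"] entry[of n 1 1] entry[of n 1 2] entry[of n 2 1] entry[of n 2 2]
    by linarith
  show ?thesis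
  proof (rule summable_comparison_test'[where N = 0])
    show "summable (\<lambda>n. 4 * M * (norm (series_coeff \<rho> (dual12 x) (dual21 x) y n) * \<bar>s\<bar> ^ n))"
      by (intro summable_mult series_coeff_summable continuous_dual x y)
    show "norm (norm (minus_coeff x y n) * s ^ n) \<le> 4 * M * (norm (series_coeff \<rho> (dual12 x) (dual21 x) y n) * \<bar>s\<bar> ^ n)" for n
      using mult_right_mono[OF norm_le[of n], of "\<bar>s\<bar> ^ n"] by (simp add: abs_mult power_abs mult.assoc)
  qed
qed

text \<open>Along vertical segments the off-diagonal part carries the inverse of the loop parameter,
  so the same series argument applies with \<open>inverse z\<close> in place of
  \<open>z\<close>.\<close>

lemma eval_minus_coeff:
  assumes x: "\<bar>x\<bar> \<le> \<rho>" and y: "\<bar>y\<bar> \<le> \<rho>" and z: "z \<in> unit_circle"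
  shows "loop_eval (power_loop (minus_coeff x y)) (inverse z) =
    diag_exp (\<theta> x - \<theta> 0) ** (adj2 (loop_eval (F x 0) z) ** loop_eval (F x y) z)"
proof -
  have x0: "\<bar>0::real\<bar> \<le> \<rho>"
    using x by linarith
  have z': "inverse z \<in> unit_circle" and nz: "norm (inverse z) = 1"
    using z by (simp_all add: norm_inverse)
  have s1: "summable (\<lambda>n. norm (minus_coeff x y n))"
    using minus_coeff_summable[OF x y, of 1] by simp
  \<comment> \<open>The framing is restarted at the foot of the vertical segment, where
    \<open>Z\<close> is the identity; \<open>Y\<close> is its gauged form.\<close>
  define Z where "Z t = adj2 (loop_eval (F x 0) z) ** loop_eval (F x t) z" for t
  define Y where "Y t = Z t ** diag_exp (\<eta> x 0 - \<eta> x t)" for t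
  have "(Z has_vector_derivative Z t ** mat2 (of_real (\<eta>' x t)) (inverse z * of_real (\<gamma> x t))
          (inverse z * of_real (\<delta> x t)) (- of_real (\<eta>' x t))) (at t)" if "\<bar>t\<bar> \<le> \<rho>" for t
    unfolding Z_def[abs_def] by (rule matrix_mult_left_derivative[OF F_y[OF x that z]])
  from gauge_derivative[OF this \<eta>[OF x], where c = "\<eta> x 0"]
  have Y': "(Y has_vector_derivative Y t ** mat2 0 (inverse z * of_real (dual12 x t)) (inverse z * of_real (dual21 x t)) 0) (at t)"
    if "\<bar>t\<bar> \<le> \<rho>" for t
    using that unfolding Y_def[abs_def] by (simp add: dual12_def dual21_def diag_exp_def)
  have Y0: "Y 0 = mat 1"
    by (simp add: Y_def Z_def diag_exp_0 adj2_inverse(2)[OF det_F[OF x x0 z]])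
  have Y_sums: "(\<lambda>n. complex_of_real (series_coeff \<rho> (dual12 x) (dual21 x) y n $ i $ k) * inverse z ^ n) sums Y y $ i $ k" for i k
    by (rule matrix_system_series[OF continuous_dual[OF x] Y' Y0 nz y])
  have "(\<lambda>n. complex_of_real (minus_coeff x y n $ i $ k) * inverse z ^ n) sums
      (diag_exp (\<theta> x - \<theta> 0) ** (Y y ** diag_exp (\<eta> x y - \<eta> x 0))) $ i $ k" for i k
  proof -
    let ?a = "complex_of_real (if i = 1 then exp (\<theta> x - \<theta> 0) else exp (\<theta> 0 - \<theta> x))"
    let ?b = "complex_of_real (if k = 1 then exp (\<eta> x y - \<eta> x 0) else exp (\<eta> x 0 - \<eta> x y))"
    have "\<forall>i k. (diag_exp (\<theta> x - \<theta> 0) ** (Y y ** diag_exp (\<eta> x y - \<eta> x 0))) $ i $ k =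
      complex_of_real (if i = 1 then exp (\<theta> x - \<theta> 0) else exp (\<theta> 0 - \<theta> x)) * Y y $ i $ k *
      complex_of_real (if k = 1 then exp (\<eta> x y - \<eta> x 0) else exp (\<eta> x 0 - \<eta> x y))"
      unfolding forall_entry2 by (simp add: matrix2_mult_nth diag_exp_def)
    then have "(diag_exp (\<theta> x - \<theta> 0) ** (Y y ** diag_exp (\<eta> x y - \<eta> x 0))) $ i $ k = ?a * Y y $ i $ k * ?b"
      by blast
    moreover have "(\<lambda>n. ?a * (complex_of_real (series_coeff \<rho> (dual12 x) (dual21 x) y n $ i $ k) * inverse z ^ n) * ?b) sums
        (?a * Y y $ i $ k * ?b)"
      by (intro sums_mult sums_mult2 Y_sums)
    moreover have "(\<lambda>n. ?a * (complex_of_real (series_coeff \<rho> (dual12 x) (dual21 x) y n $ i $ k) * inverse z ^ n) * ?b) =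
        (\<lambda>n. complex_of_real (minus_coeff x y n $ i $ k) * inverse z ^ n)"
      unfolding minus_coeff_nth of_real_mult by (simp only: mult_ac)
    ultimately show ?thesis
      by simp
  qed
  moreover have "Y y ** diag_exp (\<eta> x y - \<eta> x 0) = Z y"
    by (simp add: Y_def diag_exp_mult diag_exp_0 flip: matrix_mul_assoc)
  ultimately show ?thesis
    unfolding Z_def by (simp add: vec_eq_iff loop_eval_power_loop[OF s1 z'] sums_unique[symmetric])
qed

lemma eval_minus_part:
  assumes "\<bar>x\<bar> \<le> \<rho>" and "\<bar>y\<bar> \<le> \<rho>" and "z \<in> unit_circle"
  shows "loop_eval (minus_part x y) z =
    diag_exp (\<theta> x - \<theta> 0) ** (adj2 (loop_eval (F x 0) z) ** loop_eval (F x y) z)"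
  by (simp only: minus_part_def loop_eval_reflect eval_minus_coeff[OF assms])

lemma minus_part_loop_minus:
  assumes x: "\<bar>x\<bar> \<le> \<rho>" and y: "\<bar>y\<bar> \<le> \<rho>"
  shows "minus_part x y \<in> loop_minus"
  unfolding minus_part_def loop_reflect_minus
proof (rule power_loop_plus)
  show "summable (\<lambda>n. norm (minus_coeff x y n) * r ^ n)" for r
    by (rule minus_coeff_summable[OF x y])
  show "minus_coeff x y n $ i $ k \<noteq> 0 \<Longrightarrow> even n \<longleftrightarrow> i = k" for n i k
    using series_coeff_parity[of \<rho> "dual12 x" "dual21 x" y n i k] by (auto simp: minus_coeff_nth)
  fix z :: complex assume z: "z \<in> unit_circle"
  \<comment> \<open>The criterion concerns the unreflected series at \<open>z\<close>, whereas its
    closed form is written at an inverse; the formulas are therefore used at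
    \<open>inverse z\<close>.\<close>
  then have z': "inverse z \<in> unit_circle"
    by (simp add: norm_inverse)
  have x0: "\<bar>0::real\<bar> \<le> \<rho>"
    using x by linarith
  have "det (adj2 (loop_eval (F x 0) (inverse z))) = 1"
    using det_F[OF x x0 z'] by (simp add: det_2 algebra_simps)
  then show "det (loop_eval (power_loop (minus_coeff x y)) z) = 1"
    using eval_minus_coeff[OF x y z'] by (simp add: det_mul det_diag_exp det_F[OF x y z'])
qed

text \<open>The gauges and the framing on the axis cancel in the product. Together with uniqueness
  this makes the decomposition predicate an explicit equation, from which the definite description
  is evaluated at once.\<close>

lemma birkhoff:
  assumes x: "\<bar>x\<bar> \<le> \<rho>" and y: "\<bar>y\<bar> \<le> \<rho>"
  shows "birkhoff_pm (F x y) P \<longleftrightarrow> P = (plus_part x, minus_part x y)"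
proof -
  have x0: "\<bar>0::real\<bar> \<le> \<rho>"
    using x by linarith
  have "loop_eval (F x y) z = loop_eval (plus_part x) z ** loop_eval (minus_part x y) z"
    if z: "z \<in> unit_circle" for z
  proof -
    have "loop_eval (plus_part x) z ** loop_eval (minus_part x y) z =
       loop_eval (F x 0) z ** (diag_exp (\<theta> 0 - \<theta> x) ** diag_exp (\<theta> x - \<theta> 0)) **
         adj2 (loop_eval (F x 0) z) ** loop_eval (F x y) z"
      by (simp only: eval_plus_part[OF x z] eval_minus_part[OF x y z] matrix_mul_assoc)
    also have "\<dots> = loop_eval (F x y) z"
      by (simp add: diag_exp_mult diag_exp_0 adj2_inverse(1)[OF det_F[OF x x0 z]])
    finally show ?thesis by simp
  qed
  then have "birkhoff_pm (F x y) (plus_part x, minus_part x y)"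
    by (simp add: birkhoff_pm_def plus_part_star[OF x] minus_part_loop_minus[OF x y] loop_mult_eq_def)
  then show ?thesis
    using birkhoff_pm_unique[of "F x y"] by (metis prod.collapse)
qed

lemma birkhoff_exists_unique: "\<bar>x\<bar> \<le> \<rho> \<Longrightarrow> \<bar>y\<bar> \<le> \<rho> \<Longrightarrow> \<exists>!P. birkhoff_pm (F x y) P"
  by (simp add: birkhoff)

lemma plus_factor_eq: "\<bar>x\<bar> \<le> \<rho> \<Longrightarrow> \<bar>y\<bar> \<le> \<rho> \<Longrightarrow> plus_factor (F x y) = plus_part x"
  by (simp add: plus_factor_def birkhoff)

end

text \<open>Reflection is an involution, hence a bijection between the decompositions of the two
  kinds; unique existence and the chosen factor are transported along it.\<close>

lemma minus_factor_reflect: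
  assumes "\<exists>!P. birkhoff_pm (loop_reflect \<gamma>) P"
  shows "\<exists>!P. birkhoff_mp \<gamma> P" and "minus_factor \<gamma> = loop_reflect (plus_factor (loop_reflect \<gamma>))"
proof -
  define r where "r = map_prod loop_reflect loop_reflect"
  have rr: "r (r P) = P" for P
    by (cases P) (simp add: r_def)
  have mp: "birkhoff_mp \<gamma> P \<longleftrightarrow> birkhoff_pm (loop_reflect \<gamma>) (r P)" for P
    unfolding r_def by (rule birkhoff_mp_reflect)
  obtain P where P: "\<And>P'. birkhoff_pm (loop_reflect \<gamma>) P' \<longleftrightarrow> P' = P"
    using assms by blast
  have iff: "birkhoff_mp \<gamma> P' \<longleftrightarrow> P' = r P" for P'
    unfolding mp P using rr by metis
  show "\<exists>!P. birkhoff_mp \<gamma> P"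
    unfolding iff by simp
  show "minus_factor \<gamma> = loop_reflect (plus_factor (loop_reflect \<gamma>))"
    unfolding minus_factor_def plus_factor_def iff P by (simp add: r_def)
qed

text \<open>When a factor depends only on one coordinate \<open>l\<close> of the point, the chain
  rule gives its logarithmic derivative as the one-dimensional one times \<open>l v\<close>.\<close>

lemma maurer_cartan_pullback:
  fixes X M :: "complex^2^2"
  assumes l: "bounded_linear l" and W: "open W" "p \<in> W"
    and G: "\<And>q. q \<in> W \<Longrightarrow> loop_eval (G q) z = Y (l q)"
    and Y: "(Y has_vector_derivative Y (l p) ** M) (at (l p))" and det: "det (Y (l p)) = 1"
  shows "(\<lambda>q. loop_eval (G q) z) differentiable (at p)"
    and "maurer_cartan G z p v = l v *\<^sub>R M"
proof -
  have "((\<lambda>q. Y (l q)) has_derivative (\<lambda>v. l v *\<^sub>R (Y (l p) ** M))) (at p)"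
    using has_derivative_compose[OF bounded_linear_imp_has_derivative[OF l] Y[unfolded has_vector_derivative_def]] .
  then have d: "((\<lambda>q. loop_eval (G q) z) has_derivative (\<lambda>v. l v *\<^sub>R (Y (l p) ** M))) (at p)"
    by (rule has_derivative_transform_within_open[OF _ W]) (simp add: G)
  then show "(\<lambda>q. loop_eval (G q) z) differentiable (at p)"
    by (rule differentiableI)
  have "l v *\<^sub>R (Y (l p) ** M) = Y (l p) ** (l v *\<^sub>R M)"
    by (simp add: matrix2_eq_iff matrix2_mult_nth scaleR_add_right)
  then show "maurer_cartan G z p v = l v *\<^sub>R M"
    by (simp add: maurer_cartan_def frechet_derivative_at[OF d, symmetric] G[OF W(2)] matrix_inv_cancel[OF det])
qed

section \<open>The normalized potentials\<close>

lemma smooth_on_continuous: "smooth_on S f \<Longrightarrow> continuous_on S f"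
  unfolding smooth_on_def by (metis Ck_on.simps(1))

lemma smooth_on_differentiable: "smooth_on S f \<Longrightarrow> f differentiable_on S"
  unfolding smooth_on_def by (metis Ck_on.simps(2))

lemma smooth_on_pd:
  assumes "smooth_on S f"
  shows "smooth_on S (pd_x f)" and "smooth_on S (pd_y f)"
  using assms unfolding smooth_on_def by (metis Ck_on.simps(2))+

text \<open>\<open>pd_x\<close> and \<open>pd_y\<close> are meaningful only where the slices are
  differentiable; total differentiability on an open set guarantees this.\<close>

lemma partial_derivatives:
  fixes f :: "real \<times> real \<Rightarrow> 'a::real_normed_vector"
  assumes "f differentiable_on S" and "open S" and p: "(x, y) \<in> S"
  shows "((\<lambda>t. f (t, y)) has_vector_derivative pd_x f (x, y)) (at x)"
    and "((\<lambda>t. f (x, t)) has_vector_derivative pd_y f (x, y)) (at y)"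
proof -
  have "f differentiable (at (x, y))"
    using assms by (metis at_within_open differentiable_on_def)
  then obtain f' where f': "(f has_derivative f') (at (x, y))"
    unfolding differentiable_def by blast
  have "((\<lambda>t. (t, y)) has_derivative (\<lambda>h. (h, 0))) (at x)" "((\<lambda>t. (x, t)) has_derivative (\<lambda>h. (0, h))) (at y)"
    by (auto intro!: derivative_eq_intros)
  from has_derivative_compose[OF this(1) f'] has_derivative_compose[OF this(2) f']
  have "(\<lambda>t. f (t, y)) differentiable (at x)" "(\<lambda>t. f (x, t)) differentiable (at y)"
    by (auto intro: differentiableI)
  then show "((\<lambda>t. f (t, y)) has_vector_derivative pd_x f (x, y)) (at x)"
    "((\<lambda>t. f (x, t)) has_vector_derivative pd_y f (x, y)) (at y)"
    by (simp_all add: pd_x_def pd_y_def vector_derivative_works)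
qed

lemma continuous_on_mink:
  assumes "continuous_on S u" and "continuous_on S v"
  shows "continuous_on S (\<lambda>p. mink (u p) (v p))"
  unfolding mink_def by (intro continuous_intros assms)

lemma framing_U_eq:
  "framing_U H \<omega> Q z p = mat2 (of_real (pd_x \<omega> p / 4)) (z * of_real (- (H / 2 * exp (\<omega> p / 2))))
    (z * of_real (Q p * exp (- \<omega> p / 2))) (- of_real (pd_x \<omega> p / 4))"
  by (simp add: framing_U_def mat2_def)

lemma framing_V_eq:
  "framing_V H \<omega> R z p = mat2 (of_real (- pd_y \<omega> p / 4)) (inverse z * of_real (- (R p * exp (- \<omega> p / 2))))
    (inverse z * of_real (H / 2 * exp (\<omega> p / 2))) (- of_real (- pd_y \<omega> p / 4))"
  by (simp add: framing_V_def mat2_def)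

theorem theorem5p2:
  fixes D :: "(real \<times> real) set"
    and \<phi> N :: "real \<times> real \<Rightarrow> real^3"
    and \<omega> :: "real \<times> real \<Rightarrow> real"
    and H :: real
    and Q R :: "real \<Rightarrow> real"
    and \<Phi> :: "real \<times> real \<Rightarrow> loop"
  assumes "open D" and "connected D" and "simply_connected D" and "(0, 0) \<in> D"
    and "timelike_on D \<phi>"
    and "null_coordinates D \<phi> \<omega>"
    and "unit_normal_field D \<phi> N"
    and "\<forall>p\<in>D. mean_curvature \<phi> N \<omega> p = H"
    and "\<forall>\<^sub>F (x, y) in nhds (0, 0). hopf_Q \<phi> N (x, y) = Q x"
    and "\<forall>\<^sub>F (x, y) in nhds (0, 0). hopf_R \<phi> N (x, y) = R y"
    and "extended_framing D \<phi> N \<omega> H \<Phi>"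
  shows "let f = (\<lambda>x. exp (\<omega> (x, 0) - \<omega> (0, 0) / 2));
             g = (\<lambda>y. exp (\<omega> (0, y) - \<omega> (0, 0) / 2))
         in \<exists>W. open W \<and> (0, 0) \<in> W \<and> W \<subseteq> D \<and>
              (\<forall>p\<in>W. (\<exists>!P. birkhoff_pm (\<Phi> p) P) \<and> (\<exists>!P. birkhoff_mp (\<Phi> p) P)) \<and>
              (\<forall>x y. (x, y) \<in> W \<longrightarrow> (\<forall>z\<in>unit_circle.
                 (\<lambda>q. loop_eval (plus_factor (\<Phi> q)) z) differentiable (at (x, y)) \<and>
                 (\<lambda>q. loop_eval (minus_factor (\<Phi> q)) z) differentiable (at (x, y)) \<and>
                 (\<forall>dx dy.
                    normalized_potential_x \<Phi> z (x, y) (dx, dy) =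
                      dx *\<^sub>R vector [vector [0, z * of_real (- H / 2 * f x)],
                                   vector [z * of_real (Q x / f x), 0]] \<and>
                    normalized_potential_y \<Phi> z (x, y) (dx, dy) =
                      dy *\<^sub>R vector [vector [0, inverse z * of_real (- R y / g y)],
                                   vector [inverse z * of_real (H / 2 * g y), 0]])))"
proof -
  have \<omega>_smooth: "smooth_on D \<omega>" and N_smooth: "smooth_on D N" and \<phi>_smooth: "smooth_on D \<phi>"
    using assms by (simp_all add: null_coordinates_def unit_normal_field_def timelike_on_def immersion_on_def)
  note \<omega>_cont = smooth_on_continuous[OF \<omega>_smooth]
    and \<omega>_partial = partial_derivatives[OF smooth_on_differentiable[OF \<omega>_smooth] \<open>open D\<close>]
  have Q_cont: "continuous_on D (hopf_Q \<phi> N)" and R_cont: "continuous_on D (hopf_R \<phi> N)"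
    unfolding hopf_Q_def[abs_def] hopf_R_def[abs_def]
    by (intro continuous_on_mink smooth_on_continuous smooth_on_pd \<phi>_smooth N_smooth)+
  \<comment> \<open>The functions \<open>Q\<close> and \<open>R\<close> describe the Hopf
    differentials only near the origin, so one radius is chosen to secure this together with
    membership in \<open>D\<close>.\<close>
  have "\<forall>\<^sub>F p in nhds (0, 0). p \<in> D \<and> hopf_Q \<phi> N p = Q (fst p) \<and> hopf_R \<phi> N p = R (snd p)"
    using eventually_nhds_in_open[OF \<open>open D\<close> \<open>(0, 0) \<in> D\<close>] assms(9,10)
    by eventually_elim (auto simp: split_beta)
  then obtain d where d: "d > 0" and near: "\<And>p. dist p (0, 0) < d \<Longrightarrow>
      p \<in> D \<and> hopf_Q \<phi> N p = Q (fst p) \<and> hopf_R \<phi> N p = R (snd p)"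
    unfolding eventually_nhds_metric by blast
  \<comment> \<open>Two coordinates of size at most a third of \<open>d\<close> give a norm below
    \<open>d\<close>, so the closed box lies in the good ball.\<close>
  define \<rho> where "\<rho> = d / 3"
  have \<rho>: "\<rho> > 0"
    using d by (simp add: \<rho>_def)
  have box: "(x, y) \<in> D" "hopf_Q \<phi> N (x, y) = Q x" "hopf_R \<phi> N (x, y) = R y"
    if "\<bar>x\<bar> \<le> \<rho>" "\<bar>y\<bar> \<le> \<rho>" for x y
  proof -
    have "norm (x, y) \<le> \<bar>x\<bar> + \<bar>y\<bar>"
      using norm_Pair_le[of x y] by simp
    then have "dist (x, y) (0, 0) < d"
      using that d by (simp add: \<rho>_def dist_norm)
    from near[OF this] show "(x, y) \<in> D" "hopf_Q \<phi> N (x, y) = Q x" "hopf_R \<phi> N (x, y) = R y"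
      by simp_all
  qed
  have slice_x: "continuous_on {-\<rho>..\<rho>} (\<lambda>t. f (t, y))" if "\<bar>y\<bar> \<le> \<rho>" "continuous_on D f" for f :: "real \<times> real \<Rightarrow> real" and y
    by (rule continuous_on_compose2[OF that(2)]) (use that(1) box(1) in \<open>auto intro!: continuous_intros simp: abs_le_iff minus_le_iff\<close>)
  have slice_y: "continuous_on {-\<rho>..\<rho>} (\<lambda>t. f (x, t))" if "\<bar>x\<bar> \<le> \<rho>" "continuous_on D f" for f :: "real \<times> real \<Rightarrow> real" and x
    by (rule continuous_on_compose2[OF that(2)]) (use that(1) box(1) in \<open>auto intro!: continuous_intros simp: abs_le_iff minus_le_iff\<close>)
  have \<Phi>0: "\<Phi> (0, 0) = one_loop" and \<Phi>_group: "\<And>p. p \<in> D \<Longrightarrow> \<Phi> p \<in> loop_group"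
    and \<Phi>_x: "\<And>x y z. (x, y) \<in> D \<Longrightarrow> z \<in> unit_circle \<Longrightarrow> ((\<lambda>t. loop_eval (\<Phi> (t, y)) z) has_vector_derivative
           loop_eval (\<Phi> (x, y)) z ** framing_U H \<omega> (hopf_Q \<phi> N) z (x, y)) (at x)"
    and \<Phi>_y: "\<And>x y z. (x, y) \<in> D \<Longrightarrow> z \<in> unit_circle \<Longrightarrow> ((\<lambda>t. loop_eval (\<Phi> (x, t)) z) has_vector_derivative
           loop_eval (\<Phi> (x, y)) z ** framing_V H \<omega> (hopf_R \<phi> N) z (x, y)) (at y)"
    using assms(11) loop_group_an_subset unfolding extended_framing_def by blast+
  have \<rho>0: "\<bar>0::real\<bar> \<le> \<rho>"
    using \<rho> by simp
  have \<omega>_x: "((\<lambda>t. \<omega> (t, y) / 4) has_real_derivative pd_x \<omega> (x, y) / 4) (at x)"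
    and \<omega>_y: "((\<lambda>t. \<omega> (x, t) / 4) has_real_derivative pd_y \<omega> (x, y) / 4) (at y)" if "(x, y) \<in> D" for x y
    using \<omega>_partial[OF that] unfolding has_real_derivative_iff_has_vector_derivative[symmetric]
    by (auto intro!: derivative_eq_intros)
  \<comment> \<open>The diagonal entries of U and V integrate to \<open>\<omega> / 4\<close> in
    \<open>x\<close> and \<open>- \<omega> / 4\<close> in \<open>y\<close>, which are the exponents
    of the two gauges.\<close>
  interpret X: box_framing \<rho> "\<lambda>x y. \<Phi> (x, y)" "\<lambda>x. \<omega> (x, 0) / 4" "\<lambda>x. pd_x \<omega> (x, 0) / 4"
    "\<lambda>x. - (H / 2 * exp (\<omega> (x, 0) / 2))" "\<lambda>x. hopf_Q \<phi> N (x, 0) * exp (- \<omega> (x, 0) / 2)"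
    "\<lambda>x y. - \<omega> (x, y) / 4" "\<lambda>x y. - pd_y \<omega> (x, y) / 4"
    "\<lambda>x y. - (hopf_R \<phi> N (x, y) * exp (- \<omega> (x, y) / 2))" "\<lambda>x y. H / 2 * exp (\<omega> (x, y) / 2)"
  proof
    fix x y :: real and z :: complex assume x: "\<bar>x\<bar> \<le> \<rho>"
    show "((\<lambda>x. \<omega> (x, 0) / 4) has_real_derivative pd_x \<omega> (x, 0) / 4) (at x)"
      by (rule \<omega>_x[OF box(1)[OF x \<rho>0]])
    show "continuous_on {-\<rho>..\<rho>} (\<lambda>y. - (hopf_R \<phi> N (x, y) * exp (- \<omega> (x, y) / 2)))"
      "continuous_on {-\<rho>..\<rho>} (\<lambda>y. H / 2 * exp (\<omega> (x, y) / 2))"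
      by (intro continuous_intros slice_y[OF x] R_cont \<omega>_cont; simp)+
    show "((\<lambda>t. loop_eval (\<Phi> (t, 0)) z) has_vector_derivative loop_eval (\<Phi> (x, 0)) z **
        mat2 (of_real (pd_x \<omega> (x, 0) / 4)) (z * of_real (- (H / 2 * exp (\<omega> (x, 0) / 2))))
        (z * of_real (hopf_Q \<phi> N (x, 0) * exp (- \<omega> (x, 0) / 2))) (- of_real (pd_x \<omega> (x, 0) / 4))) (at x)"
      if "z \<in> unit_circle"
      using \<Phi>_x[OF box(1)[OF x \<rho>0] that] unfolding framing_U_eq .
    assume y: "\<bar>y\<bar> \<le> \<rho>"
    show "\<Phi> (x, y) \<in> loop_group"
      by (intro \<Phi>_group box(1) x y)
    show "((\<lambda>t. loop_eval (\<Phi> (x, t)) z) has_vector_derivative loop_eval (\<Phi> (x, y)) z **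
        mat2 (of_real (- pd_y \<omega> (x, y) / 4)) (inverse z * of_real (- (hopf_R \<phi> N (x, y) * exp (- \<omega> (x, y) / 2))))
        (inverse z * of_real (H / 2 * exp (\<omega> (x, y) / 2))) (- of_real (- pd_y \<omega> (x, y) / 4))) (at y)"
      if "z \<in> unit_circle"
      using \<Phi>_y[OF box(1)[OF x y] that] unfolding framing_V_eq .
    show "((\<lambda>y. - \<omega> (x, y) / 4) has_real_derivative - pd_y \<omega> (x, y) / 4) (at y)"
      using DERIV_minus[OF \<omega>_y[OF box(1)[OF x y]]] by simp
  next
    show "\<Phi> (0, 0) = one_loop"
      by (rule \<Phi>0)
    show "continuous_on {-\<rho>..\<rho>} (\<lambda>x. - (H / 2 * exp (\<omega> (x, 0) / 2)))"
      "continuous_on {-\<rho>..\<rho>} (\<lambda>x. hopf_Q \<phi> N (x, 0) * exp (- \<omega> (x, 0) / 2))"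
      by (intro continuous_intros slice_x[OF \<rho>0] Q_cont \<omega>_cont; simp)+
  qed
  \<comment> \<open>Exchanging the coordinates and inverting the parameter lets V play the role of
    U: its off-diagonal part now carries the parameter itself, and the gauge exponents trade
    places.\<close>
  interpret Y: box_framing \<rho> "\<lambda>x y. loop_reflect (\<Phi> (y, x))" "\<lambda>x. - \<omega> (0, x) / 4" "\<lambda>x. - pd_y \<omega> (0, x) / 4"
    "\<lambda>x. - (hopf_R \<phi> N (0, x) * exp (- \<omega> (0, x) / 2))" "\<lambda>x. H / 2 * exp (\<omega> (0, x) / 2)"
    "\<lambda>x y. \<omega> (y, x) / 4" "\<lambda>x y. pd_x \<omega> (y, x) / 4"
    "\<lambda>x y. - (H / 2 * exp (\<omega> (y, x) / 2))" "\<lambda>x y. hopf_Q \<phi> N (y, x) * exp (- \<omega> (y, x) / 2)"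
  proof
    fix x y :: real and z :: complex assume x: "\<bar>x\<bar> \<le> \<rho>"
    have z': "inverse z \<in> unit_circle" if "z \<in> unit_circle"
      using that by (simp add: norm_inverse)
    show "((\<lambda>x. - \<omega> (0, x) / 4) has_real_derivative - pd_y \<omega> (0, x) / 4) (at x)"
      using DERIV_minus[OF \<omega>_y[OF box(1)[OF \<rho>0 x]]] by simp
    show "continuous_on {-\<rho>..\<rho>} (\<lambda>y. - (H / 2 * exp (\<omega> (y, x) / 2)))"
      "continuous_on {-\<rho>..\<rho>} (\<lambda>y. hopf_Q \<phi> N (y, x) * exp (- \<omega> (y, x) / 2))"
      by (intro continuous_intros slice_x[OF x] Q_cont \<omega>_cont; simp)+
    show "((\<lambda>t. loop_eval (loop_reflect (\<Phi> (0, t))) z) has_vector_derivative loop_eval (loop_reflect (\<Phi> (0, x))) z **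
        mat2 (of_real (- pd_y \<omega> (0, x) / 4)) (z * of_real (- (hopf_R \<phi> N (0, x) * exp (- \<omega> (0, x) / 2))))
        (z * of_real (H / 2 * exp (\<omega> (0, x) / 2))) (- of_real (- pd_y \<omega> (0, x) / 4))) (at x)"
      if "z \<in> unit_circle"
      using \<Phi>_y[OF box(1)[OF \<rho>0 x] z'[OF that]]
      unfolding framing_V_eq loop_eval_reflect inverse_inverse_eq .
    assume y: "\<bar>y\<bar> \<le> \<rho>"
    show "loop_reflect (\<Phi> (y, x)) \<in> loop_group"
      unfolding loop_reflect_group by (intro \<Phi>_group box(1) x y)
    show "((\<lambda>t. loop_eval (loop_reflect (\<Phi> (t, x))) z) has_vector_derivative loop_eval (loop_reflect (\<Phi> (y, x))) z **
        mat2 (of_real (pd_x \<omega> (y, x) / 4)) (inverse z * of_real (- (H / 2 * exp (\<omega> (y, x) / 2))))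
        (inverse z * of_real (hopf_Q \<phi> N (y, x) * exp (- \<omega> (y, x) / 2))) (- of_real (pd_x \<omega> (y, x) / 4))) (at y)"
      if "z \<in> unit_circle"
      using \<Phi>_x[OF box(1)[OF y x] z'[OF that]]
      unfolding framing_U_eq loop_eval_reflect .
    show "((\<lambda>y. \<omega> (y, x) / 4) has_real_derivative pd_x \<omega> (y, x) / 4) (at y)"
      by (rule \<omega>_x[OF box(1)[OF y x]])
  next
    show "loop_reflect (\<Phi> (0, 0)) = one_loop"
      by (simp add: \<Phi>0 loop_reflect_def one_loop_def fun_eq_iff)
    show "continuous_on {-\<rho>..\<rho>} (\<lambda>x. - (hopf_R \<phi> N (0, x) * exp (- \<omega> (0, x) / 2)))"
      "continuous_on {-\<rho>..\<rho>} (\<lambda>x. H / 2 * exp (\<omega> (0, x) / 2))"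
      by (intro continuous_intros slice_y[OF \<rho>0] R_cont \<omega>_cont; simp)+
  qed
  \<comment> \<open>The open box, since the plus factors are differentiated only at interior
    parameters.\<close>
  define W where "W = {-\<rho><..<\<rho>} \<times> {-\<rho><..<\<rho>}"
  have W: "\<bar>fst p\<bar> < \<rho>" "\<bar>snd p\<bar> < \<rho>" if "p \<in> W" for p
    using that by (auto simp: W_def abs_less_iff)
  note W' = W[THEN less_imp_le]
  have openW: "open W"
    unfolding W_def by (intro open_Times) auto
  have minus: "\<exists>!P. birkhoff_mp (\<Phi> p) P" "minus_factor (\<Phi> p) = loop_reflect (Y.plus_part (snd p))" if "p \<in> W" for p
    using minus_factor_reflect[of "\<Phi> p"] Y.birkhoff_exists_unique[OF W'(2,1)[OF that]]
      Y.plus_factor_eq[OF W'(2,1)[OF that]] by simp_all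
  have plus: "\<exists>!P. birkhoff_pm (\<Phi> p) P" "plus_factor (\<Phi> p) = X.plus_part (fst p)" if "p \<in> W" for p
    using X.birkhoff_exists_unique[OF W'[OF that]] X.plus_factor_eq[OF W'[OF that]] by simp_all

  \<comment> \<open>Evaluation of the potentials\<close>
  let ?f = "\<lambda>x. exp (\<omega> (x, 0) - \<omega> (0, 0) / 2)" and ?g = "\<lambda>y. exp (\<omega> (0, y) - \<omega> (0, 0) / 2)"
  \<comment> \<open>The gauge contributes \<open>(\<omega> (x, 0) - \<omega> (0, 0)) / 2\<close> to
    the exponent and the entry of U contributes \<open>\<omega> (x, 0) / 2\<close>; their sum is the
    exponent of \<open>f\<close>.\<close>
  have pot12_X: "X.pot12 x = - H / 2 * ?f x" for x
    unfolding X.pot12_def by (simp add: field_simps flip: exp_add)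
  \<comment> \<open>The opposite exponents give the reciprocal of \<open>f\<close>; the bound on
    \<open>x\<close> allows the Hopf differential to be replaced by \<open>Q x\<close>.\<close>
  have pot21_X: "X.pot21 x = Q x / ?f x" if "\<bar>x\<bar> < \<rho>" for x
    unfolding X.pot21_def using box(2)[of x 0] that \<rho> by (simp add: exp_diff exp_minus field_simps flip: exp_add)
  have pot12_Y: "Y.pot12 y = - R y / ?g y" if "\<bar>y\<bar> < \<rho>" for y
    unfolding Y.pot12_def using box(3)[of 0 y] that \<rho> by (simp add: exp_diff exp_minus field_simps flip: exp_add)
  have pot21_Y: "Y.pot21 y = H / 2 * ?g y" for y
    unfolding Y.pot21_def by (simp add: field_simps flip: exp_add)
  have main: "(\<lambda>q. loop_eval (plus_factor (\<Phi> q)) z) differentiable (at p)"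
    "normalized_potential_x \<Phi> z p v = fst v *\<^sub>R mat2 0 (z * of_real (- H / 2 * ?f (fst p))) (z * of_real (Q (fst p) / ?f (fst p))) 0"
    "(\<lambda>q. loop_eval (minus_factor (\<Phi> q)) z) differentiable (at p)"
    "normalized_potential_y \<Phi> z p v = snd v *\<^sub>R mat2 0 (inverse z * of_real (- R (snd p) / ?g (snd p)))
      (inverse z * of_real (H / 2 * ?g (snd p))) 0"
    if p: "p \<in> W" and z: "z \<in> unit_circle" for p z v
  proof -
    have z': "inverse z \<in> unit_circle"
      using z by (simp add: norm_inverse)
    note x = W(1)[OF p] and y = W(2)[OF p]
    note 1 = maurer_cartan_pullback[OF bounded_linear_fst openW p, where G = "\<lambda>q. plus_factor (\<Phi> q)" and z = z
        and Y = "\<lambda>t. loop_eval (X.plus_part t) z", OF _ X.plus_part_derivative[OF x z] X.det_plus_part[OF less_imp_le[OF x] z]]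
    \<comment> \<open>The minus factor is the reflection of a plus factor, so that factor is
      evaluated at \<open>inverse z\<close> and depends on the second coordinate.\<close>
    note 2 = maurer_cartan_pullback[OF bounded_linear_snd openW p, where G = "\<lambda>q. minus_factor (\<Phi> q)" and z = z
        and Y = "\<lambda>t. loop_eval (Y.plus_part t) (inverse z)", OF _ Y.plus_part_derivative[OF y z'] Y.det_plus_part[OF less_imp_le[OF y] z']]
    show "(\<lambda>q. loop_eval (plus_factor (\<Phi> q)) z) differentiable (at p)"
      by (rule 1(1)) (simp add: plus)
    show "(\<lambda>q. loop_eval (minus_factor (\<Phi> q)) z) differentiable (at p)"
      by (rule 2(1)) (simp add: minus loop_eval_reflect)
    show "normalized_potential_x \<Phi> z p v = fst v *\<^sub>R mat2 0 (z * of_real (- H / 2 * ?f (fst p))) (z * of_real (Q (fst p) / ?f (fst p))) 0"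
      unfolding normalized_potential_x_def pot12_X[symmetric] pot21_X[OF x, symmetric]
      by (rule 1(2)) (simp add: plus)
    show "normalized_potential_y \<Phi> z p v = snd v *\<^sub>R mat2 0 (inverse z * of_real (- R (snd p) / ?g (snd p)))
      (inverse z * of_real (H / 2 * ?g (snd p))) 0"
      unfolding normalized_potential_y_def pot12_Y[OF y, symmetric] pot21_Y[symmetric]
      by (rule 2(2)) (simp add: minus loop_eval_reflect)
  qed
  have "(0, 0) \<in> W" "W \<subseteq> D"
    using \<rho> box(1) W' by (auto simp: W_def abs_le_iff)
  moreover note pot_x = main(2)[where p = "(x, y)" and v = "(dx, dy)" for x y dx dy, unfolded fst_conv snd_conv]
    and pot_y = main(4)[where p = "(x, y)" and v = "(dx, dy)" for x y dx dy, unfolded fst_conv snd_conv]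
  ultimately show ?thesis
    unfolding Let_def mat2_def[symmetric]
    by (intro exI[of _ W] conjI allI impI ballI openW plus(1) minus(1) main(1,3) pot_x pot_y)
qed

end
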